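(* For the lossy Gray–Wyner problem with side information described in the context, $\mathcal{R}^{\mathrm{inner}*}_{\mathrm{LGW}}\subseteq\mathcal{R}^{\mathrm{inner}}_{\mathrm{LGW}}\subseteq\mathcal{R}_{\mathrm{LGW}}$, and the region $\mathcal{R}^{\mathrm{inner}}_{\mathrm{LGW}}$ is convex.
   Context: Fix finite alphabets $\mathcal{X},\mathcal{Y}_1,\mathcal{Y}_2,\mathcal{V}_1,\mathcal{V}_2$, a joint law $P_{XY_1Y_2}$ on $\mathcal{X}\times\mathcal{Y}_1\times\mathcal{Y}_2$, and conditional laws $P_{V_1|X}$, $P_{V_2|X}$. Let $(X_t,Y_{1,t},Y_{2,t})_{t=1}^n$ be i.i.d. $\sim P_{XY_1Y_2}$. A sender observes $X^n$; receiver $i\in\{1,2\}$ observes $Y_i^n$. An encoder $\lambda^{(n)}:\mathcal{X}^n\to[2^{nR_0}]\times[2^{nR_1}]\times[2^{nR_2}]$ produces $(K_0,K_1,K_2)=\lambda^{(n)}(X^n)$ (with $[M]=\{1,\dots,\lfloor M\rfloor\}$); receiver $i$ gets $(K_0,K_i)$ noiselessly and outputs $\hat V_i^n=\Lambda_i^{(n)}(K_0,K_i,Y_i^n)\in\mathcal{V}_i^n$. Typicality: $x^n$ is $\epsilon$-typical w.r.t. $P_X$ if $|\pi_{x^n}(x)-P_X(x)|\le\epsilon P_X(x)$ for all $x$ ($\pi_{x^n}$ the empirical distribution); $\mathcal{T}^n_\epsilon(\cdot)$ denotes the (jointly) typical set. A triple $(R_0,R_1,R_2)$ is $\epsilon$-achievable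 if there are encoders/reconstruction functions with $\Pr((X^n,\hat V_i^n)\notin\mathcal{T}^n_\epsilon(P_{XV_i}))\to0$ as $n\to\infty$ for $i=1,2$, where $P_{XV_i}=P_X P_{V_i|X}$; it is achievable if $\epsilon$-achievable for all $\epsilon>0$. $\mathcal{R}_{\mathrm{LGW}}$ is the closure of the set of achievable triples. $\mathcal{R}^{\mathrm{inner}}_{\mathrm{LGW}}$ is the closure of the set of nonnegative $(R_0,R_1,R_2)$ such that, for some finite alphabet $\mathcal{V}_0$ and some conditional law $P_{V_0V_1V_2|X}$ whose $(V_1|X)$ and $(V_2|X)$ marginals equal $P_{V_1|X}$ and $P_{V_2|X}$, with $(V_0,V_1,V_2)-X-(Y_1,Y_2)$ a Markov chain: $R_1>I(X;V_1|V_0,Y_1)$, $R_2>I(X;V_2|V_0,Y_2)$, $R_0+R_1>I(X;V_0,V_1|Y_1)$, $R_0+R_2>I(X;V_0,V_2|Y_2)$. $\mathcal{R}^{\mathrm{inner}*}_{\mathrm{LGW}}$ is defined in the same way but with the constraints $R_0>\max_{i\in\{1,2\}}I(X;V_0|Y_i)$, $R_1>I(X;V_1|V_0,Y_1)$, $R_2>I(X;V_2|V_0,Y_2)$. *)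

theory Defs
  imports "HOL-Probability.Probability"
begin

text \<open>Shannon entropy (base 2) of a finitely supported pmf; terms with zero mass are
  excluded since only the support is summed over (convention 0 log 0 = 0).\<close>
definition entropy_pmf :: "'a pmf \<Rightarrow> real" where
  "entropy_pmf p = - (\<Sum>a\<in>set_pmf p. pmf p a * log 2 (pmf p a))"

definition Ent :: "'w pmf \<Rightarrow> ('w \<Rightarrow> 'a) \<Rightarrow> real" where
  "Ent J f = entropy_pmf (map_pmf f J)"

definition cmi :: "'w pmf \<Rightarrow> ('w \<Rightarrow> 'a) \<Rightarrow> ('w \<Rightarrow> 'b) \<Rightarrow> ('w \<Rightarrow> 'c) \<Rightarrow> real" where
  "cmi J A B C = Ent J (\<lambda>w. (A w, C w)) + Ent J (\<lambda>w. (B w, C w))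
                 - Ent J (\<lambda>w. (A w, B w, C w)) - Ent J C"

text \<open>The auxiliary alphabet V0 is represented by a finite subset of nat.  The joint
  law is P_{XY1Y2}(x,y1,y2) * P_{V0V1V2|X}(v0,v1,v2|x), which builds in the Markov chain
  (V0,V1,V2) - X - (Y1,Y2).\<close>
definition joint_law ::
  "('x \<times> 'y1 \<times> 'y2) pmf \<Rightarrow> ('x \<Rightarrow> (nat \<times> 'v1 \<times> 'v2) pmf)
     \<Rightarrow> (('x \<times> 'y1 \<times> 'y2) \<times> (nat \<times> 'v1 \<times> 'v2)) pmf" where
  "joint_law P Q = bind_pmf P (\<lambda>s. map_pmf (\<lambda>v. (s, v)) (Q (fst s)))"

definition rvX :: "('x \<times> 'y1 \<times> 'y2) \<times> (nat \<times> 'v1 \<times> 'v2) \<Rightarrow> 'x" where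
  "rvX w = fst (fst w)"
definition rvY1 :: "('x \<times> 'y1 \<times> 'y2) \<times> (nat \<times> 'v1 \<times> 'v2) \<Rightarrow> 'y1" where
  "rvY1 w = fst (snd (fst w))"
definition rvY2 :: "('x \<times> 'y1 \<times> 'y2) \<times> (nat \<times> 'v1 \<times> 'v2) \<Rightarrow> 'y2" where
  "rvY2 w = snd (snd (fst w))"
definition rvV0 :: "('x \<times> 'y1 \<times> 'y2) \<times> (nat \<times> 'v1 \<times> 'v2) \<Rightarrow> nat" where
  "rvV0 w = fst (snd w)"
definition rvV1 :: "('x \<times> 'y1 \<times> 'y2) \<times> (nat \<times> 'v1 \<times> 'v2) \<Rightarrow> 'v1" where
  "rvV1 w = fst (snd (snd w))"
definition rvV2 :: "('x \<times> 'y1 \<times> 'y2) \<times> (nat \<times> 'v1 \<times> 'v2) \<Rightarrow> 'v2" where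
  "rvV2 w = snd (snd (snd w))"

definition admissible ::
  "('x \<Rightarrow> 'v1 pmf) \<Rightarrow> ('x \<Rightarrow> 'v2 pmf) \<Rightarrow> ('x \<Rightarrow> (nat \<times> 'v1 \<times> 'v2) pmf) \<Rightarrow> bool" where
  "admissible PV1 PV2 Q \<longleftrightarrow>
     (\<exists>V0::nat set. finite V0 \<and> (\<forall>x. fst ` set_pmf (Q x) \<subseteq> V0)) \<and>
     (\<forall>x. map_pmf (\<lambda>v. fst (snd v)) (Q x) = PV1 x) \<and>
     (\<forall>x. map_pmf (\<lambda>v. snd (snd v)) (Q x) = PV2 x)"

definition R_inner ::
  "('x \<times> 'y1 \<times> 'y2) pmf \<Rightarrow> ('x \<Rightarrow> 'v1 pmf) \<Rightarrow> ('x \<Rightarrow> 'v2 pmf) \<Rightarrow> (real \<times> real \<times> real) set" where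
  "R_inner P PV1 PV2 = closure {(R0, R1, R2). R0 \<ge> 0 \<and> R1 \<ge> 0 \<and> R2 \<ge> 0 \<and>
     (\<exists>Q. admissible PV1 PV2 Q \<and>
        (let J = joint_law P Q in
          R1 > cmi J rvX rvV1 (\<lambda>w. (rvV0 w, rvY1 w)) \<and>
          R2 > cmi J rvX rvV2 (\<lambda>w. (rvV0 w, rvY2 w)) \<and>
          R0 + R1 > cmi J rvX (\<lambda>w. (rvV0 w, rvV1 w)) rvY1 \<and>
          R0 + R2 > cmi J rvX (\<lambda>w. (rvV0 w, rvV2 w)) rvY2))}"

definition R_inner_star ::
  "('x \<times> 'y1 \<times> 'y2) pmf \<Rightarrow> ('x \<Rightarrow> 'v1 pmf) \<Rightarrow> ('x \<Rightarrow> 'v2 pmf) \<Rightarrow> (real \<times> real \<times> real) set" where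
  "R_inner_star P PV1 PV2 = closure {(R0, R1, R2). R0 \<ge> 0 \<and> R1 \<ge> 0 \<and> R2 \<ge> 0 \<and>
     (\<exists>Q. admissible PV1 PV2 Q \<and>
        (let J = joint_law P Q in
          R0 > max (cmi J rvX rvV0 rvY1) (cmi J rvX rvV0 rvY2) \<and>
          R1 > cmi J rvX rvV1 (\<lambda>w. (rvV0 w, rvY1 w)) \<and>
          R2 > cmi J rvX rvV2 (\<lambda>w. (rvV0 w, rvY2 w))))}"

definition emp :: "'a list \<Rightarrow> 'a \<Rightarrow> real" where
  "emp zs a = real (card {i. i < length zs \<and> zs ! i = a}) / real (length zs)"

definition typical :: "real \<Rightarrow> 'a pmf \<Rightarrow> 'a list \<Rightarrow> bool" where
  "typical \<epsilon> p zs \<longleftrightarrow> (\<forall>a. \<bar>emp zs a - pmf p a\<bar> \<le> \<epsilon> * pmf p a)"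

definition jtypical :: "real \<Rightarrow> ('a \<times> 'b) pmf \<Rightarrow> 'a list \<Rightarrow> 'b list \<Rightarrow> bool" where
  "jtypical \<epsilon> p xs vs \<longleftrightarrow> length xs = length vs \<and> typical \<epsilon> p (zip xs vs)"

definition law_XV :: "('x \<times> 'y1 \<times> 'y2) pmf \<Rightarrow> ('x \<Rightarrow> 'v pmf) \<Rightarrow> ('x \<times> 'v) pmf" where
  "law_XV P PV = bind_pmf (map_pmf fst P) (\<lambda>x. map_pmf (\<lambda>v. (x, v)) (PV x))"

definition prob_iid :: "'a pmf \<Rightarrow> nat \<Rightarrow> ('a list \<Rightarrow> bool) \<Rightarrow> real" where
  "prob_iid P n E = (\<Sum>ws\<in>{ws. length ws = n \<and> E ws}. (\<Prod>a\<leftarrow>ws. pmf P a))"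

definition idx :: "real \<Rightarrow> nat set" where
  "idx M = {1..nat \<lfloor>M\<rfloor>}"

definition eps_achievable ::
  "('x \<times> 'y1 \<times> 'y2) pmf \<Rightarrow> ('x \<Rightarrow> 'v1 pmf) \<Rightarrow> ('x \<Rightarrow> 'v2 pmf) \<Rightarrow> real
     \<Rightarrow> real \<times> real \<times> real \<Rightarrow> bool" where
  "eps_achievable P PV1 PV2 \<epsilon> R \<longleftrightarrow>
    (case R of (R0, R1, R2) \<Rightarrow>
     (\<exists>(enc :: nat \<Rightarrow> 'x list \<Rightarrow> nat \<times> nat \<times> nat)
       (dec1 :: nat \<Rightarrow> nat \<Rightarrow> nat \<Rightarrow> 'y1 list \<Rightarrow> 'v1 list)
       (dec2 :: nat \<Rightarrow> nat \<Rightarrow> nat \<Rightarrow> 'y2 list \<Rightarrow> 'v2 list).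
        (\<forall>n xs. length xs = n \<longrightarrow>
           fst (enc n xs) \<in> idx (2 powr (real n * R0)) \<and>
           fst (snd (enc n xs)) \<in> idx (2 powr (real n * R1)) \<and>
           snd (snd (enc n xs)) \<in> idx (2 powr (real n * R2))) \<and>
        (\<lambda>n. prob_iid P n (\<lambda>ws.
           let xs = map fst ws; k = enc n xs in
           \<not> jtypical \<epsilon> (law_XV P PV1) xs
               (dec1 n (fst k) (fst (snd k)) (map (\<lambda>w. fst (snd w)) ws))))
          \<longlonglongrightarrow> 0 \<and>
        (\<lambda>n. prob_iid P n (\<lambda>ws.
           let xs = map fst ws; k = enc n xs in
           \<not> jtypical \<epsilon> (law_XV P PV2) xs
               (dec2 n (fst k) (snd (snd k)) (map (\<lambda>w. snd (snd w)) ws))))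
          \<longlonglongrightarrow> 0))"

definition achievable ::
  "('x \<times> 'y1 \<times> 'y2) pmf \<Rightarrow> ('x \<Rightarrow> 'v1 pmf) \<Rightarrow> ('x \<Rightarrow> 'v2 pmf) \<Rightarrow> real \<times> real \<times> real \<Rightarrow> bool" where
  "achievable P PV1 PV2 R \<longleftrightarrow> (\<forall>\<epsilon>>0. eps_achievable P PV1 PV2 \<epsilon> R)"

definition R_LGW ::
  "('x \<times> 'y1 \<times> 'y2) pmf \<Rightarrow> ('x \<Rightarrow> 'v1 pmf) \<Rightarrow> ('x \<Rightarrow> 'v2 pmf) \<Rightarrow> (real \<times> real \<times> real) set" where
  "R_LGW P PV1 PV2 = closure {R. achievable P PV1 PV2 R}"

end

theory Submission
  imports Defs
begin

text \<open>Achievability uses exponential races in place of typicality coding. Give every \<open>u\<close> of a finite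
  alphabet an independent standard exponential clock \<open>\<omega> u\<close>; the minimiser of \<open>\<omega> u / p u\<close> has law \<open>p\<close>,
  and if sender and receiver run races with weights \<open>p\<close> and \<open>q\<close> on the same clocks, both are won by \<open>u\<close>
  with probability at least \<open>p u * q u / (p u + q u)\<close>. To send \<open>V\<^sub>0\<close>, attach uniform bin indices to it: the
  sender races with \<open>P(v\<^sub>0 | x)\<close> spread over all bins, receiver \<open>i\<close> with \<open>P(v\<^sub>0 | y\<^sub>i)\<close> restricted to the bins
  it was told, so they agree unless \<open>P(v\<^sub>0 | x) / P(v\<^sub>0 | y\<^sub>i)\<close> exceeds the number of bins; by the law of
  large numbers this takes a rate just above \<open>I(X; V\<^sub>0 | Y\<^sub>i)\<close>. Given \<open>V\<^sub>0\<close>, the same is done for \<open>V\<^sub>i\<close>, at a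
  rate just above \<open>I(X; V\<^sub>i | V\<^sub>0, Y\<^sub>i)\<close>. Since \<open>R\<^sub>0\<close> alone may be too small for \<open>V\<^sub>0\<close>, the surplus
  \<open>R\<^sub>i - I(X; V\<^sub>i | V\<^sub>0, Y\<^sub>i)\<close> of the private link carries further bin indices of \<open>V\<^sub>0\<close>; by the chain rule this
  suffices exactly when \<open>R\<^sub>0 + R\<^sub>i > I(X; V\<^sub>0, V\<^sub>i | Y\<^sub>i)\<close>. The clocks are finally fixed to values that do at
  least as well as the average.

  The inclusion of the starred region is the chain rule, and convexity follows by time sharing with the
  time-sharing bit made part of \<open>V\<^sub>0\<close>.\<close>

section \<open>Exponential races\<close>

text \<open>The comparison of \<open>\<omega> u / p u\<close> with \<open>\<omega> w / p w\<close>
  is cross-multiplied so that zero weights need no division. Strictness excludes ties, so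
  \<open>U\<close> contains at most one winner.\<close>

definition wins_race :: "'u set \<Rightarrow> ('u \<Rightarrow> real) \<Rightarrow> ('u \<Rightarrow> real) \<Rightarrow> 'u \<Rightarrow> bool" where
  "wins_race U \<omega> p u \<longleftrightarrow> (\<forall>w\<in>U - {u}. p w * \<omega> u < p u * \<omega> w)"

lemma wins_race_unique:
  assumes "wins_race U \<omega> p u" "wins_race U \<omega> p u'" "u \<in> U" "u' \<in> U"
  shows "u = u'"
proof (rule ccontr)
  assume "u \<noteq> u'"
  with assms have "p u' * \<omega> u < p u * \<omega> u'" "p u * \<omega> u' < p u' * \<omega> u"
    by (auto simp: wins_race_def)
  then show False by simp
qed

text \<open>Arbitrary when nobody wins strictly. The success bounds are derived from outcomes with
  strict winners, where the value is determined.\<close>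

definition race_winner :: "'u set \<Rightarrow> ('u \<Rightarrow> real) \<Rightarrow> ('u \<Rightarrow> real) \<Rightarrow> 'u" where
  "race_winner U \<omega> p = (THE u. u \<in> U \<and> wins_race U \<omega> p u)"

lemma race_winner_eq:
  assumes "u \<in> U" "wins_race U \<omega> p u"
  shows "race_winner U \<omega> p = u"
  unfolding race_winner_def using assms by (blast intro: wins_race_unique)

abbreviation std_exponential :: "real measure" where
  "std_exponential \<equiv> density lborel (exponential_density 1)"

lemma emeasure_std_exponential_gt:
  assumes "0 \<le> a"
  shows "emeasure std_exponential {a<..} = ennreal (exp (- a))"
proof -
  interpret prob_space std_exponential by (rule prob_space_exponential_density) simp
  have "distributed std_exponential lborel (\<lambda>x. x) (exponential_density 1)"
    unfolding distributed_def by (auto simp: distr_id2)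
  from exponential_distributedD_gt[OF this assms]
  have "measure std_exponential {a<..} = exp (- a)"
    by (simp add: greaterThan_def)
  then show ?thesis by (simp add: emeasure_eq_measure)
qed

text \<open>The Laplace transform of the exponential law: the integrand times the density of rate 1
  is \<open>1 / (1 + s)\<close> times the density of rate \<open>1 + s\<close>, whose total mass is
  1.\<close>

lemma nn_integral_std_exponential_exp:
  assumes "0 \<le> (s::real)"
  shows "(\<integral>\<^sup>+ x. ennreal (exp (- (s * x))) \<partial>std_exponential) = ennreal (1 / (1 + s))"
proof -
  interpret prob_space "density lborel (exponential_density (1 + s))"
    by (rule prob_space_exponential_density) (use assms in simp)
  have one: "(\<integral>\<^sup>+ x. ennreal (exponential_density (1 + s) x) \<partial>lborel) = 1"
    using emeasure_space_1 by (simp add: emeasure_density)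
  have "(\<integral>\<^sup>+ x. ennreal (exp (- (s * x))) \<partial>std_exponential) =
    (\<integral>\<^sup>+ x. ennreal (1 / (1 + s)) * ennreal (exponential_density (1 + s) x) \<partial>lborel)"
    using assms
    by (auto simp: nn_integral_density exponential_density_def ennreal_mult[symmetric] exp_add[symmetric]
        ring_distribs mult.commute add_divide_distrib[symmetric] divide_simps intro!: nn_integral_cong)
  also have "\<dots> = ennreal (1 / (1 + s))"
    using one by (simp add: nn_integral_cmult)
  finally show ?thesis .
qed

lemma measurable_wins_race:
  assumes "finite U" "u \<in> U"
  shows "Measurable.pred (PiM U (\<lambda>_. std_exponential)) (\<lambda>\<omega>. wins_race U \<omega> p u)"
  unfolding wins_race_def
proof (rule pred_intros_finite)
  show "finite (U - {u})" using assms by simp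
  fix w assume "w \<in> U - {u}"
  then have [measurable]: "(\<lambda>\<omega>. \<omega> w) \<in> borel_measurable (PiM U (\<lambda>_. std_exponential))"
    "(\<lambda>\<omega>. \<omega> u) \<in> borel_measurable (PiM U (\<lambda>_. std_exponential))"
    using measurable_component_singleton[of w U "\<lambda>_. std_exponential"]
      measurable_component_singleton[of u U "\<lambda>_. std_exponential"] assms by simp_all
  show "Measurable.pred (PiM U (\<lambda>_. std_exponential)) (\<lambda>\<omega>. p w * \<omega> u < p u * \<omega> w)"
    by measurable
qed

text \<open>Condition on the value \<open>x\<close> of the clock of \<open>u\<close>. Independently,
  each other clock exceeds \<open>r w * x\<close> with probability \<open>exp (- (r w * x))\<close>;
  the product is a single exponential in \<open>x\<close>, and its mean is a value of the Laplace
  transform.\<close>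

lemma prob_exponential_race:
  fixes r :: "'u \<Rightarrow> real"
  assumes "finite V" "u \<notin> V" "\<And>w. w \<in> V \<Longrightarrow> 0 \<le> r w"
  defines "M \<equiv> PiM (insert u V) (\<lambda>_. std_exponential)"
  shows "emeasure M {\<omega> \<in> space M. \<forall>w\<in>V. r w * \<omega> u < \<omega> w} = ennreal (1 / (1 + (\<Sum>w\<in>V. r w)))"
proof -
  interpret E: prob_space std_exponential by (rule prob_space_exponential_density) simp
  interpret product_prob_space "\<lambda>_. std_exponential" "insert u V" by unfold_locales
  let ?G = "{\<omega> \<in> space M. \<forall>w\<in>V. r w * \<omega> u < \<omega> w}"
  have G: "?G \<in> sets M"
    unfolding M_def using \<open>finite V\<close> by measurable
  have "emeasure M ?G = (\<integral>\<^sup>+ \<omega>. indicator ?G \<omega> \<partial>M)"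
    using G by simp
  also have "\<dots> = (\<integral>\<^sup>+ x. (\<integral>\<^sup>+ \<omega>. indicator ?G (fun_upd \<omega> u x) \<partial>PiM V (\<lambda>_. std_exponential)) \<partial>std_exponential)"
    unfolding M_def
    by (rule product_nn_integral_insert_rev) (use assms G in \<open>auto simp: M_def\<close>)
  also have "\<dots> = (\<integral>\<^sup>+ x. ennreal (exp (- ((\<Sum>w\<in>V. r w) * x))) \<partial>std_exponential)"
  proof (rule nn_integral_cong_AE)
    \<comment> \<open>The exponential tail formula needs a nonnegative threshold, hence the
      restriction to nonnegative \<open>x\<close>.\<close>
    have "AE x in std_exponential. 0 \<le> x"
      by (subst AE_density) (auto simp: exponential_density_def)
    then show "AE x in std_exponential.
      (\<integral>\<^sup>+ \<omega>. indicator ?G (fun_upd \<omega> u x) \<partial>PiM V (\<lambda>_. std_exponential)) = ennreal (exp (- ((\<Sum>w\<in>V. r w) * x)))"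
    proof eventually_elim
      case (elim x)
      have "(\<integral>\<^sup>+ \<omega>. indicator ?G (fun_upd \<omega> u x) \<partial>PiM V (\<lambda>_. std_exponential)) =
        (\<integral>\<^sup>+ \<omega>. indicator (Pi\<^sub>E V (\<lambda>w. {r w * x<..})) \<omega> \<partial>PiM V (\<lambda>_. std_exponential))"
        using \<open>u \<notin> V\<close>
        by (intro nn_integral_cong)
          (auto simp: M_def space_PiM indicator_def PiE_def Pi_def extensional_def)
      also have "\<dots> = emeasure (PiM V (\<lambda>_. std_exponential)) (Pi\<^sub>E V (\<lambda>w. {r w * x<..}))"
        using \<open>finite V\<close> by (intro nn_integral_indicator sets_PiM_I_finite) auto
      also have "\<dots> = (\<Prod>w\<in>V. emeasure std_exponential {r w * x<..})"
        using \<open>finite V\<close> by (intro emeasure_PiM) auto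
      also have "\<dots> = (\<Prod>w\<in>V. ennreal (exp (- (r w * x))))"
        using assms elim by (intro prod.cong emeasure_std_exponential_gt) auto
      also have "\<dots> = ennreal (exp (- ((\<Sum>w\<in>V. r w) * x)))"
        using \<open>finite V\<close> by (simp add: prod_ennreal exp_sum[symmetric] sum_negf sum_distrib_right)
      finally show ?case .
    qed
  qed
  also have "\<dots> = ennreal (1 / (1 + (\<Sum>w\<in>V. r w)))"
    using assms by (intro nn_integral_std_exponential_exp sum_nonneg)
  finally show ?thesis .
qed

text \<open>Finite-alphabet form of the Poisson matching lemma of Li and Anantharam.\<close>
lemma prob_wins_both_races:
  fixes p q :: "'u \<Rightarrow> real"
  assumes "finite U" "u \<in> U" and nonneg: "\<And>w. w \<in> U \<Longrightarrow> 0 \<le> p w" "\<And>w. w \<in> U \<Longrightarrow> 0 \<le> q w"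
    and le1: "sum p U \<le> 1" "sum q U \<le> 1" and pos: "0 < p u" and le: "p u \<le> \<eta> * q u"
    and eta: "0 \<le> \<eta>"
  defines "M \<equiv> PiM U (\<lambda>_. std_exponential)"
  shows "p u / (1 + \<eta>) \<le> measure M {\<omega> \<in> space M. wins_race U \<omega> p u \<and> wins_race U \<omega> q u}"
proof -
  interpret E: prob_space std_exponential by (rule prob_space_exponential_density) simp
  interpret product_prob_space "\<lambda>_. std_exponential" U by unfold_locales
  define V where "V = U - {u}"
  have UV: "U = insert u V" "u \<notin> V" "finite V" using assms by (auto simp: V_def)
  have qpos: "0 < q u"
    using pos le eta nonneg(2)[OF \<open>u \<in> U\<close>] by (cases "q u = 0") auto
  \<comment> \<open>For positive \<open>p u\<close> and \<open>q u\<close> and a nonnegative clock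
    of \<open>u\<close>, beating \<open>w\<close> in both races means passing the larger of two
    thresholds, so a single race with weights \<open>r\<close> decides both.\<close>
  define r where "r w = max (p w / p u) (q w / q u)" for w
  have iff: "wins_race U \<omega> p u \<and> wins_race U \<omega> q u \<longleftrightarrow> (\<forall>w\<in>V. r w * \<omega> u < \<omega> w)"
    if "\<omega> u \<ge> 0" for \<omega>
  proof -
    have "p w * \<omega> u < p u * \<omega> w \<and> q w * \<omega> u < q u * \<omega> w \<longleftrightarrow> r w * \<omega> u < \<omega> w" for w
    proof -
      have "r w * \<omega> u = max (p w / p u * \<omega> u) (q w / q u * \<omega> u)"
        unfolding r_def by (rule max_mult_distrib_right[THEN trans]) (use that in auto)
      then show ?thesis using pos qpos by (simp add: field_simps)
    qed
    then show ?thesis unfolding wins_race_def V_def by blast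
  qed
  let ?A = "{\<omega> \<in> space M. wins_race U \<omega> p u \<and> wins_race U \<omega> q u}"
  let ?B = "{\<omega> \<in> space M. \<forall>w\<in>V. r w * \<omega> u < \<omega> w}"
  note [measurable] = measurable_wins_race[OF \<open>finite U\<close> \<open>u \<in> U\<close>]
  have mA: "?A \<in> sets M" unfolding M_def by measurable
  have mB: "?B \<in> sets M" unfolding M_def UV(1) using \<open>finite V\<close> by measurable
  have AE0: "AE \<omega> in M. 0 \<le> \<omega> u"
    unfolding M_def by (rule AE_component[OF \<open>u \<in> U\<close>])
      (subst AE_density, auto simp: exponential_density_def)
  have "measure M ?A = measure M ?B"
    by (rule measure_eq_AE) (use AE0 mA mB iff in auto)
  also have "\<dots> = 1 / (1 + (\<Sum>w\<in>V. r w))"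
  proof -
    have rn: "0 \<le> r w" if "w \<in> V" for w
      using nonneg that pos UV by (auto simp: r_def le_max_iff_disj)
    show ?thesis
      using prob_exponential_race[OF UV(3,2) rn] rn unfolding M_def UV(1)
      by (simp add: measure_def sum_nonneg)
  qed
  finally have eq: "measure M ?A = 1 / (1 + (\<Sum>w\<in>V. r w))" .
  have sp: "sum p V = sum p U - p u" "sum q V = sum q U - q u"
    using UV by simp_all
  \<comment> \<open>A maximum of nonnegative numbers is at most their sum. Together with
    \<open>1 / q u \<le> \<eta> / p u\<close> this bounds the denominator
    \<open>1 + (\<Sum>w\<in>V. r w)\<close> by \<open>(1 + \<eta>) / p u\<close>.\<close>
  have "(\<Sum>w\<in>V. r w) \<le> (\<Sum>w\<in>V. p w / p u + q w / q u)"
    using nonneg pos qpos UV by (intro sum_mono) (auto simp: r_def)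
  also have "\<dots> = sum p V / p u + sum q V / q u"
    by (simp add: sum.distrib sum_divide_distrib)
  also have "\<dots> \<le> (1 - p u) / p u + (1 - q u) / q u"
    using sp le1 pos qpos by (intro add_mono divide_right_mono) auto
  also have "\<dots> \<le> 1 / p u + 1 / q u - 1 - 1"
    using pos qpos by (simp add: field_simps)
  also have "1 / q u \<le> \<eta> / p u"
    using pos qpos le by (simp add: field_simps)
  finally have "1 + (\<Sum>w\<in>V. r w) \<le> (1 + \<eta>) / p u" by (simp add: add_divide_distrib)
  moreover have "0 < 1 + (\<Sum>w\<in>V. r w)"
    using nonneg pos UV by (intro add_pos_nonneg sum_nonneg) (auto simp: r_def le_max_iff_disj)
  ultimately have "1 / ((1 + \<eta>) / p u) \<le> 1 / (1 + (\<Sum>w\<in>V. r w))"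
    by (intro divide_left_mono) (use pos eta in auto)
  then show ?thesis using eq by simp
qed

section \<open>Fixing the clocks\<close>

text \<open>The left side is the mean of the random variable on the right, and a random variable
  cannot lie strictly below its mean everywhere.\<close>

lemma (in prob_space) exists_ge_weighted_prob:
  assumes "finite I" "\<And>i. i \<in> I \<Longrightarrow> G i \<in> events"
  shows "\<exists>\<omega>\<in>space M. (\<Sum>i\<in>I. c i * prob (G i)) \<le> (\<Sum>i\<in>I. c i * indicator (G i) \<omega> :: real)"
proof (rule ccontr)
  let ?f = "\<lambda>\<omega>. \<Sum>i\<in>I. c i * indicator (G i) \<omega> :: real"
  assume "\<not> ?thesis"
  then have lt: "\<And>\<omega>. \<omega> \<in> space M \<Longrightarrow> ?f \<omega> < (\<Sum>i\<in>I. c i * prob (G i))" by force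
  have int: "integrable M (\<lambda>\<omega>. c i * indicator (G i) \<omega> :: real)" if "i \<in> I" for i
    using assms that by (intro integrable_mult_right integrable_real_indicator) (auto simp: emeasure_eq_measure)
  have "expectation ?f = (\<Sum>i\<in>I. c i * prob (G i))"
    using assms int by (subst Bochner_Integration.integral_sum) auto
  moreover have "expectation ?f < (\<Sum>i\<in>I. c i * prob (G i))"
  proof -
    have "integrable M ?f" using int by auto
    then show ?thesis
      using lt by (intro integral_less_AE_space[THEN order_less_le_trans, of _ "\<lambda>_. \<Sum>i\<in>I. c i * prob (G i)"])
        (auto simp: emeasure_space_1 prob_space)
  qed
  ultimately show False by simp
qed

text \<open>All races of the family \<open>I\<close> share one clock vector, so the matching bound
  may be averaged over \<open>I\<close> with weights \<open>c\<close> before a single good value of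
  the clocks is chosen.\<close>

lemma exists_race_clocks:
  fixes p q :: "'i \<Rightarrow> 'u \<Rightarrow> real" and c :: "'i \<Rightarrow> real"
  assumes "finite U" "finite I" "0 \<le> \<eta>"
    and "\<And>i. i \<in> I \<Longrightarrow> u i \<in> U"
    and "\<And>i. i \<in> I \<Longrightarrow> 0 \<le> c i"
    and "\<And>i w. i \<in> I \<Longrightarrow> w \<in> U \<Longrightarrow> 0 \<le> p i w"
    and "\<And>i w. i \<in> I \<Longrightarrow> w \<in> U \<Longrightarrow> 0 \<le> q i w"
    and "\<And>i. i \<in> I \<Longrightarrow> sum (p i) U \<le> 1"
    and "\<And>i. i \<in> I \<Longrightarrow> sum (q i) U \<le> 1"
    and "\<And>i. i \<in> I \<Longrightarrow> p i (u i) \<le> \<eta> * q i (u i)"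
  shows "\<exists>\<omega>. (\<Sum>i\<in>I. c i * p i (u i)) / (1 + \<eta>) \<le>
    (\<Sum>i | i \<in> I \<and> wins_race U \<omega> (p i) (u i) \<and> wins_race U \<omega> (q i) (u i). c i)"
proof -
  let ?M = "PiM U (\<lambda>_. std_exponential)"
  interpret E: prob_space std_exponential by (rule prob_space_exponential_density) simp
  interpret product_prob_space "\<lambda>_. std_exponential" U by unfold_locales
  let ?G = "\<lambda>i. {\<omega> \<in> space ?M. wins_race U \<omega> (p i) (u i) \<and> wins_race U \<omega> (q i) (u i)}"
  have "?G i \<in> sets ?M" if "i \<in> I" for i
  proof -
    note [measurable] = measurable_wins_race[OF \<open>finite U\<close> assms(4)[OF that]]
    show ?thesis by measurable
  qed
  from P.exists_ge_weighted_prob[where G = ?G and c = c, OF \<open>finite I\<close> this]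
  obtain \<omega> where \<omega>: "\<omega> \<in> space ?M"
    "(\<Sum>i\<in>I. c i * measure ?M (?G i)) \<le> (\<Sum>i\<in>I. c i * indicator (?G i) \<omega>)" by auto
  have "(\<Sum>i\<in>I. c i * p i (u i)) / (1 + \<eta>) = (\<Sum>i\<in>I. c i * (p i (u i) / (1 + \<eta>)))"
    by (simp add: sum_divide_distrib)
  also have "\<dots> \<le> (\<Sum>i\<in>I. c i * measure ?M (?G i))"
  proof (intro sum_mono mult_left_mono)
    fix i assume i: "i \<in> I"
    show "p i (u i) / (1 + \<eta>) \<le> measure ?M (?G i)"
    \<comment> \<open>The matching bound assumes a positive weight; for weight 0 the left side is
      0.\<close>
    proof (cases "p i (u i) = 0")
      case False
      then have "0 < p i (u i)" using assms(4,6)[of i] i by (simp add: order_less_le)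
      then show ?thesis using assms i by (intro prob_wins_both_races) auto
    qed simp
  qed (use assms in auto)
  also have "\<dots> \<le> (\<Sum>i\<in>I. c i * indicator (?G i) \<omega>)" by fact
  also have "\<dots> = (\<Sum>i | i \<in> I \<and> wins_race U \<omega> (p i) (u i) \<and> wins_race U \<omega> (q i) (u i). c i)"
    unfolding sum.inter_filter[OF \<open>finite I\<close>] using \<omega>(1)
    by (intro sum.cong) (auto simp: indicator_def)
  finally show ?thesis by blast
qed

section \<open>Binned races and the one-shot code\<close>

definition binned :: "nat \<Rightarrow> ('a \<Rightarrow> real) \<Rightarrow> 'a \<times> 'k \<Rightarrow> real" where
  "binned L p = (\<lambda>(a, k). p a / real L)"

text \<open>The weights of a receiver that knows \<open>h k = m\<close>. The number \<open>N\<close>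
  stands for an upper bound on how many bins are compatible with this, so that the total mass does
  not exceed that of \<open>d\<close>.\<close>

definition binned_at :: "('k \<Rightarrow> 'm) \<Rightarrow> 'm \<Rightarrow> nat \<Rightarrow> ('a \<Rightarrow> real) \<Rightarrow> 'a \<times> 'k \<Rightarrow> real" where
  "binned_at h m N d = (\<lambda>(a, k). if h k = m then d a / real N else 0)"

lemma sum_binned: "card K > 0 \<Longrightarrow> sum (binned (card K) p) (A \<times> K) = sum p A"
  by (simp add: binned_def sum.cartesian_product[symmetric])

lemma sum_binned_at:
  assumes "finite K" "card {k \<in> K. h k = m} \<le> N" "N > 0" "\<And>a. a \<in> A \<Longrightarrow> 0 \<le> d a"
  shows "sum (binned_at h m N d) (A \<times> K) \<le> sum d A"
proof -
  have "sum (binned_at h m N d) (A \<times> K) = (\<Sum>a\<in>A. \<Sum>k | k \<in> K \<and> h k = m. d a / real N)"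
    unfolding sum.inter_filter[OF assms(1)] by (simp add: binned_at_def sum.cartesian_product)
  also have "\<dots> = (\<Sum>a\<in>A. d a * (real (card {k \<in> K. h k = m}) / real N))" by (simp add: mult.commute)
  also have "\<dots> \<le> (\<Sum>a\<in>A. d a * 1)"
    using assms by (intro sum_mono mult_left_mono) auto
  finally show ?thesis by simp
qed

text \<open>A letter with its bin has weight \<open>p / card K\<close> for the sender and
  \<open>d / N\<close> for the receiver, so knowing part of the bin index relaxes the condition on
  the ratio of \<open>p\<close> to \<open>d\<close> by the factor \<open>card K / N\<close>. The
  denominator \<open>card K\<close> cancels when the weights are summed over the bins.\<close>

lemma exists_binned_race_clocks:
  fixes p d :: "'i \<Rightarrow> 'a \<Rightarrow> real" and c :: "'i \<Rightarrow> real" and h :: "'i \<Rightarrow> 'k \<Rightarrow> 'm"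
  assumes fin: "finite A" "finite K" "K \<noteq> {}" "finite I" and eta: "0 \<le> \<eta>"
    and v: "\<And>i. i \<in> I \<Longrightarrow> v i \<in> A"
    and c: "\<And>i. i \<in> I \<Longrightarrow> 0 \<le> c i"
    and nonneg: "\<And>i a. i \<in> I \<Longrightarrow> a \<in> A \<Longrightarrow> 0 \<le> p i a"
      "\<And>i a. i \<in> I \<Longrightarrow> a \<in> A \<Longrightarrow> 0 \<le> d i a"
    and le1: "\<And>i. i \<in> I \<Longrightarrow> sum (p i) A \<le> 1" "\<And>i. i \<in> I \<Longrightarrow> sum (d i) A \<le> 1"
    and N: "\<And>i k. i \<in> I \<Longrightarrow> k \<in> K \<Longrightarrow> card {k' \<in> K. h i k' = h i k} \<le> N i"
      "\<And>i. i \<in> I \<Longrightarrow> 0 < N i"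
    and le: "\<And>i. i \<in> I \<Longrightarrow> p i (v i) * real (N i) \<le> \<eta> * real (card K) * d i (v i)"
  shows "\<exists>\<omega>. (\<Sum>i\<in>I. c i * p i (v i)) / (1 + \<eta>) \<le>
    (\<Sum>i\<in>I. \<Sum>k\<in>K. c i * of_bool (wins_race (A \<times> K) \<omega> (binned (card K) (p i)) (v i, k) \<and>
       wins_race (A \<times> K) \<omega> (binned_at (h i) (h i k) (N i) (d i)) (v i, k)))"
proof -
  have K0: "card K > 0" using fin by (simp add: card_gt_0_iff)
  have "\<exists>\<omega>. (\<Sum>j\<in>I \<times> K. c (fst j) * binned (card K) (p (fst j)) (v (fst j), snd j)) / (1 + \<eta>) \<le>
    (\<Sum>j | j \<in> I \<times> K \<and> wins_race (A \<times> K) \<omega> (binned (card K) (p (fst j))) (v (fst j), snd j) \<and>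
       wins_race (A \<times> K) \<omega> (binned_at (h (fst j)) (h (fst j) (snd j)) (N (fst j)) (d (fst j))) (v (fst j), snd j). c (fst j))"
  proof (rule exists_race_clocks)
    fix j assume j: "j \<in> I \<times> K"
    then show "binned (card K) (p (fst j)) (v (fst j), snd j) \<le>
        \<eta> * binned_at (h (fst j)) (h (fst j) (snd j)) (N (fst j)) (d (fst j)) (v (fst j), snd j)"
      using le[of "fst j"] N(2)[of "fst j"] K0
      by (auto simp: binned_def binned_at_def field_simps)
    show "sum (binned (card K) (p (fst j))) (A \<times> K) \<le> 1"
      using j le1(1)[of "fst j"] K0 by (auto simp: sum_binned)
    show "sum (binned_at (h (fst j)) (h (fst j) (snd j)) (N (fst j)) (d (fst j))) (A \<times> K) \<le> 1"
      using j N(2)[of "fst j"] N(1)[of "fst j" "snd j"] fin nonneg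
      by (intro order_trans[OF sum_binned_at le1(2)[of "fst j"]]) auto
    fix w assume "w \<in> A \<times> K"
    then show "0 \<le> binned (card K) (p (fst j)) w"
       "0 \<le> binned_at (h (fst j)) (h (fst j) (snd j)) (N (fst j)) (d (fst j)) w"
      using j nonneg by (auto simp: binned_def binned_at_def)
  qed (use fin eta v c in auto)
  then obtain \<omega> where "(\<Sum>j\<in>I \<times> K. c (fst j) * binned (card K) (p (fst j)) (v (fst j), snd j)) / (1 + \<eta>) \<le>
    (\<Sum>j | j \<in> I \<times> K \<and> wins_race (A \<times> K) \<omega> (binned (card K) (p (fst j))) (v (fst j), snd j) \<and>
       wins_race (A \<times> K) \<omega> (binned_at (h (fst j)) (h (fst j) (snd j)) (N (fst j)) (d (fst j))) (v (fst j), snd j). c (fst j))"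
    by blast
  moreover have "(\<Sum>j\<in>I \<times> K. c (fst j) * binned (card K) (p (fst j)) (v (fst j), snd j)) = (\<Sum>i\<in>I. c i * p i (v i))"
    using K0 by (simp add: binned_def sum.cartesian_product' del: sum_constant)
      (simp add: sum_distrib_left[symmetric])
  ultimately show ?thesis
    using fin
    by (intro exI[of _ \<omega>]) (simp add: sum.inter_filter sum.cartesian_product' of_bool_def if_distrib cong: if_cong)
qed

lemma le_sum_image_inj:
  fixes P :: "'w \<Rightarrow> real"
  assumes "finite W" "\<And>w. w \<in> W \<Longrightarrow> 0 \<le> P w" "finite S" "inj_on f S" "f ` S \<subseteq> W"
  shows "(\<Sum>s\<in>S. P (f s)) \<le> sum P W"
proof -
  have "(\<Sum>s\<in>S. P (f s)) = sum P (f ` S)" using assms by (simp add: sum.reindex)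
  also have "\<dots> \<le> sum P W" using assms by (intro sum_mono2) auto
  finally show ?thesis .
qed

section \<open>Coding in two layers\<close>

text \<open>Second layer: the clocks \<open>\<omega>0\<close> that select \<open>(a, k)\<close> are
  already fixed, and \<open>\<omega>1\<close> is chosen for the letter \<open>b\<close>. The bound
  passes from tuples to source outcomes \<open>w\<close> because the race winners, and with them the
  whole tuple, are determined by \<open>w\<close>.\<close>

lemma satellite_success:
  fixes P :: "'w \<Rightarrow> real" and p0 :: "'s \<Rightarrow> 'a0 \<Rightarrow> real" and p1 e1 :: "_ \<Rightarrow> 'a0 \<Rightarrow> 'a1 \<Rightarrow> real"
    and h :: "nat \<times> nat \<times> nat \<Rightarrow> nat \<times> nat"
  assumes fin: "finite W" "finite A0" "finite A1" "finite K" and eta: "0 \<le> \<eta>" and M: "M > 0"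
    and P: "\<And>w. w \<in> W \<Longrightarrow> 0 \<le> P w"
    and nonneg: "\<And>w a b. w \<in> W \<Longrightarrow> a \<in> A0 \<Longrightarrow> b \<in> A1 \<Longrightarrow> 0 \<le> p1 (x w) a b"
      "\<And>w a b. w \<in> W \<Longrightarrow> a \<in> A0 \<Longrightarrow> b \<in> A1 \<Longrightarrow> 0 \<le> e1 (y w) a b"
    and le1: "\<And>w a. w \<in> W \<Longrightarrow> a \<in> A0 \<Longrightarrow> sum (p1 (x w) a) A1 \<le> 1"
      "\<And>w a. w \<in> W \<Longrightarrow> a \<in> A0 \<Longrightarrow> sum (e1 (y w) a) A1 \<le> 1"
    and T: "T \<subseteq> W \<times> A0 \<times> A1"
    and le: "\<And>w a b. (w, a, b) \<in> T \<Longrightarrow> p1 (x w) a b \<le> \<eta> * real M * e1 (y w) a b"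
  shows "\<exists>\<omega>1. (\<Sum>(w, a, b)\<in>T. \<Sum>k\<in>K. P w * p1 (x w) a b *
        of_bool (wins_race (A0 \<times> K) \<omega>0 (binned (card K) (p0 (x w))) (a, k) \<and>
           wins_race (A0 \<times> K) \<omega>0 (binned_at h (h k) N (d (y w))) (a, k))) / (1 + \<eta>) \<le>
     (\<Sum>w | w \<in> W \<and> (\<exists>a b k m. (w, a, b) \<in> T \<and> k \<in> K \<and> m < M \<and>
        race_winner (A0 \<times> K) \<omega>0 (binned (card K) (p0 (x w))) = (a, k) \<and>
        race_winner (A0 \<times> K) \<omega>0 (binned_at h (h k) N (d (y w))) = (a, k) \<and>
        race_winner (A1 \<times> {..<M}) \<omega>1 (binned M (p1 (x w) a)) = (b, m) \<and>
        race_winner (A1 \<times> {..<M}) \<omega>1 (binned_at id m 1 (e1 (y w) a)) = (b, m)). P w)"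
proof -
  define ag0 where "ag0 w a k \<longleftrightarrow> wins_race (A0 \<times> K) \<omega>0 (binned (card K) (p0 (x w))) (a, k) \<and>
           wins_race (A0 \<times> K) \<omega>0 (binned_at h (h k) N (d (y w))) (a, k)" for w a k
  define ag1 where "ag1 \<omega> w a b m \<longleftrightarrow> wins_race (A1 \<times> {..<M}) \<omega> (binned M (p1 (x w) a)) (b, m) \<and>
           wins_race (A1 \<times> {..<M}) \<omega> (binned_at id m 1 (e1 (y w) a)) (b, m)" for \<omega> w a b m
  define wi where "wi i = fst (fst i)" for i :: "('w \<times> 'a0 \<times> 'a1) \<times> nat \<times> nat \<times> nat"
  define ai where "ai i = fst (snd (fst i))" for i :: "('w \<times> 'a0 \<times> 'a1) \<times> nat \<times> nat \<times> nat"
  define bi where "bi i = snd (snd (fst i))" for i :: "('w \<times> 'a0 \<times> 'a1) \<times> nat \<times> nat \<times> nat"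
  have finT: "finite T" using T fin by (auto intro: finite_subset)
  \<comment> \<open>Agreement in the first layer does not involve the new clocks, so it is absorbed
    into the weights.\<close>
  have "\<exists>\<omega>. (\<Sum>i\<in>T \<times> K. (P (wi i) * of_bool (ag0 (wi i) (ai i) (snd i))) * p1 (x (wi i)) (ai i) (bi i)) / (1 + \<eta>)
    \<le> (\<Sum>i\<in>T \<times> K. \<Sum>m\<in>{..<M}. (P (wi i) * of_bool (ag0 (wi i) (ai i) (snd i))) *
        of_bool (wins_race (A1 \<times> {..<M}) \<omega> (binned (card {..<M}) (p1 (x (wi i)) (ai i))) (bi i, m)
        \<and> wins_race (A1 \<times> {..<M}) \<omega> (binned_at id (id m) 1 (e1 (y (wi i)) (ai i))) (bi i, m)))"
  proof (rule exists_binned_race_clocks)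
    fix k i assume "i \<in> T \<times> K" "k \<in> {..<M}"
    \<comment> \<open>The receiver is told the whole bin index of this layer: \<open>h\<close> is
      the identity, so a class of compatible bins is a singleton and \<open>N = 1\<close>.\<close>
    have "{k'\<in>{..<M}. id k' = id k} \<subseteq> {k}" by auto
    from card_mono[OF _ this] show "card {k'\<in>{..<M}. id k' = id k} \<le> 1" by simp
  next
    show "finite (T \<times> K)" using finT fin by simp
    fix i assume "i \<in> T \<times> K"
    then have i: "wi i \<in> W" "ai i \<in> A0" "bi i \<in> A1" "(wi i, ai i, bi i) \<in> T"
      using T by (auto simp: wi_def ai_def bi_def)
    show "bi i \<in> A1" by fact
    show "0 \<le> P (wi i) * of_bool (ag0 (wi i) (ai i) (snd i))" using P i by simp
    show "sum (p1 (x (wi i)) (ai i)) A1 \<le> 1" "sum (e1 (y (wi i)) (ai i)) A1 \<le> 1" using le1 i by auto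
    show "p1 (x (wi i)) (ai i) (bi i) * real 1 \<le> \<eta> * real (card {..<M}) * e1 (y (wi i)) (ai i) (bi i)"
      using le[OF i(4)] by simp
    fix a assume "a \<in> A1"
    then show "0 \<le> p1 (x (wi i)) (ai i) a" "0 \<le> e1 (y (wi i)) (ai i) a" using nonneg i by auto
  qed (use fin M eta in auto)
  then obtain \<omega>1 where 1: "(\<Sum>((w, a, b), k)\<in>T \<times> K. P w * of_bool (ag0 w a k) * p1 (x w) a b) / (1 + \<eta>)
    \<le> (\<Sum>((w, a, b), k)\<in>T \<times> K. \<Sum>m\<in>{..<M}. P w * of_bool (ag0 w a k) * of_bool (ag1 \<omega>1 w a b m))"
    unfolding ag1_def wi_def ai_def bi_def by (auto simp: case_prod_unfold)
  define S where "S = {(((w, a, b), k), m). (w, a, b) \<in> T \<and> k \<in> K \<and> m < M \<and> ag0 w a k \<and> ag1 \<omega>1 w a b m}"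
  have SI: "S = {j \<in> (T \<times> K) \<times> {..<M}. case j of (((w, a, b), k), m) \<Rightarrow> ag0 w a k \<and> ag1 \<omega>1 w a b m}"
    by (auto simp: S_def)
  have "(\<Sum>((w, a, b), k)\<in>T \<times> K. \<Sum>m\<in>{..<M}. P w * of_bool (ag0 w a k) * of_bool (ag1 \<omega>1 w a b m))
    = (\<Sum>j\<in>(T \<times> K) \<times> {..<M}. P (fst (fst (fst j))) * of_bool (case j of (((w, a, b), k), m) \<Rightarrow> ag0 w a k \<and> ag1 \<omega>1 w a b m))"
    by (subst sum.cartesian_product'[of _ "T \<times> K"]) (auto intro!: sum.cong simp: of_bool_conj case_prod_unfold)
  also have "\<dots> = (\<Sum>j\<in>S. P (fst (fst (fst j))))"
  proof -
    have "finite ((T \<times> K) \<times> {..<M})" using finT fin by simp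
    then show ?thesis unfolding SI by (intro sum.mono_neutral_cong_right) auto
  qed
  also have "\<dots> \<le> (\<Sum>w | w \<in> W \<and> (\<exists>a b k m. (w, a, b) \<in> T \<and> k \<in> K \<and> m < M \<and>
        race_winner (A0 \<times> K) \<omega>0 (binned (card K) (p0 (x w))) = (a, k) \<and>
        race_winner (A0 \<times> K) \<omega>0 (binned_at h (h k) N (d (y w))) = (a, k) \<and>
        race_winner (A1 \<times> {..<M}) \<omega>1 (binned M (p1 (x w) a)) = (b, m) \<and>
        race_winner (A1 \<times> {..<M}) \<omega>1 (binned_at id m 1 (e1 (y w) a)) = (b, m)). P w)"
    (is "_ \<le> sum P ?W")
  proof (rule le_sum_image_inj)
    have win: "race_winner (A0 \<times> K) \<omega>0 (binned (card K) (p0 (x w))) = (a, k) \<and>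
        race_winner (A0 \<times> K) \<omega>0 (binned_at h (h k) N (d (y w))) = (a, k) \<and>
        race_winner (A1 \<times> {..<M}) \<omega>1 (binned M (p1 (x w) a)) = (b, m) \<and>
        race_winner (A1 \<times> {..<M}) \<omega>1 (binned_at id m 1 (e1 (y w) a)) = (b, m)"
      if "(((w, a, b), k), m) \<in> S" for w a b k m
    proof -
      have "(a, k) \<in> A0 \<times> K" "(b, m) \<in> A1 \<times> {..<M}" "ag0 w a k" "ag1 \<omega>1 w a b m" using that T by (auto simp: S_def)
      then show ?thesis unfolding ag0_def ag1_def by (auto intro!: race_winner_eq)
    qed
    \<comment> \<open>Equal \<open>w\<close> gives the same first-layer winner
      \<open>(a, k)\<close>; then the second-layer races coincide as well, and so do their winners
      \<open>(b, m)\<close>.\<close>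
    show "inj_on (\<lambda>j. fst (fst (fst j))) S"
    proof (rule inj_onI)
      fix j j' assume j: "j \<in> S" "j' \<in> S" "fst (fst (fst j)) = fst (fst (fst j'))"
      obtain w a b k m where 1: "j = (((w, a, b), k), m)" by (metis surj_pair)
      obtain w' a' b' k' m' where 2: "j' = (((w', a', b'), k'), m')" by (metis surj_pair)
      show "j = j'" using win[of w a b k m] win[of w' a' b' k' m'] j unfolding 1 2 by auto
    qed
    show "(\<lambda>j. fst (fst (fst j))) ` S \<subseteq> ?W"
    proof
      fix w assume "w \<in> (\<lambda>j. fst (fst (fst j))) ` S"
      then obtain a b k m where j: "(((w, a, b), k), m) \<in> S" by force
      then have "w \<in> W" "(w, a, b) \<in> T" "k \<in> K" "m < M" using T by (auto simp: S_def)
      with win[OF j] show "w \<in> ?W" by blast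
    qed
    show "finite S" unfolding SI using finT fin by auto
  qed (use fin P in auto)
  finally have "(\<Sum>((w, a, b), k)\<in>T \<times> K. P w * of_bool (ag0 w a k) * p1 (x w) a b) / (1 + \<eta>) \<le> sum P ?W"
    using 1 by simp
  moreover have "(\<Sum>((w, a, b), k)\<in>T \<times> K. P w * of_bool (ag0 w a k) * p1 (x w) a b) =
    (\<Sum>(w, a, b)\<in>T. \<Sum>k\<in>K. P w * p1 (x w) a b * of_bool (ag0 w a k))"
    by (subst sum.cartesian_product') (auto intro!: sum.cong simp: case_prod_unfold)
  ultimately show ?thesis unfolding ag0_def by (intro exI[of _ \<omega>1]) simp
qed

text \<open>The preceding bound on the disjoint sum of two index sets. One clock vector has to serve
  both receivers, because the sender selects a single first-layer letter for the two of
  them.\<close>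

lemma exists_binned_race_clocks_pair:
  fixes p d :: "'i \<Rightarrow> 'a \<Rightarrow> real" and c :: "'i \<Rightarrow> real" and h h' :: "'k \<Rightarrow> 'm"
    and p' d' :: "'j \<Rightarrow> 'a \<Rightarrow> real" and c' :: "'j \<Rightarrow> real"
  assumes fin: "finite A" "finite K" "K \<noteq> {}" "finite I" "finite J" and eta: "0 \<le> \<eta>"
    and I: "\<And>i. i \<in> I \<Longrightarrow> v i \<in> A" "\<And>i. i \<in> I \<Longrightarrow> 0 \<le> c i"
      "\<And>i a. i \<in> I \<Longrightarrow> a \<in> A \<Longrightarrow> 0 \<le> p i a"
      "\<And>i a. i \<in> I \<Longrightarrow> a \<in> A \<Longrightarrow> 0 \<le> d i a"
      "\<And>i. i \<in> I \<Longrightarrow> sum (p i) A \<le> 1" "\<And>i. i \<in> I \<Longrightarrow> sum (d i) A \<le> 1"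
      "\<And>i. i \<in> I \<Longrightarrow> p i (v i) * real N \<le> \<eta> * real (card K) * d i (v i)"
    and N: "\<And>k. k \<in> K \<Longrightarrow> card {k' \<in> K. h k' = h k} \<le> N" "0 < N"
    and J: "\<And>i. i \<in> J \<Longrightarrow> v' i \<in> A" "\<And>i. i \<in> J \<Longrightarrow> 0 \<le> c' i"
      "\<And>i a. i \<in> J \<Longrightarrow> a \<in> A \<Longrightarrow> 0 \<le> p' i a"
      "\<And>i a. i \<in> J \<Longrightarrow> a \<in> A \<Longrightarrow> 0 \<le> d' i a"
      "\<And>i. i \<in> J \<Longrightarrow> sum (p' i) A \<le> 1" "\<And>i. i \<in> J \<Longrightarrow> sum (d' i) A \<le> 1"
      "\<And>i. i \<in> J \<Longrightarrow> p' i (v' i) * real N' \<le> \<eta> * real (card K) * d' i (v' i)"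
    and N': "\<And>k. k \<in> K \<Longrightarrow> card {k' \<in> K. h' k' = h' k} \<le> N'" "0 < N'"
  shows "\<exists>\<omega>. ((\<Sum>i\<in>I. c i * p i (v i)) + (\<Sum>i\<in>J. c' i * p' i (v' i))) / (1 + \<eta>) \<le>
    (\<Sum>i\<in>I. \<Sum>k\<in>K. c i * of_bool (wins_race (A \<times> K) \<omega> (binned (card K) (p i)) (v i, k) \<and>
       wins_race (A \<times> K) \<omega> (binned_at h (h k) N (d i)) (v i, k))) +
    (\<Sum>i\<in>J. \<Sum>k\<in>K. c' i * of_bool (wins_race (A \<times> K) \<omega> (binned (card K) (p' i)) (v' i, k) \<and>
       wins_race (A \<times> K) \<omega> (binned_at h' (h' k) N' (d' i)) (v' i, k)))"
proof -
  let ?H = "case_sum (\<lambda>_. h) (\<lambda>_. h')" and ?N = "case_sum (\<lambda>_. N) (\<lambda>_. N')"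
  have "\<exists>\<omega>. (\<Sum>i\<in>I <+> J. case_sum c c' i * case_sum p p' i (case_sum v v' i)) / (1 + \<eta>) \<le>
    (\<Sum>i\<in>I <+> J. \<Sum>k\<in>K. case_sum c c' i * of_bool (wins_race (A \<times> K) \<omega> (binned (card K) (case_sum p p' i)) (case_sum v v' i, k) \<and>
       wins_race (A \<times> K) \<omega> (binned_at (?H i) (?H i k) (?N i) (case_sum d d' i)) (case_sum v v' i, k)))"
    by (rule exists_binned_race_clocks) (use assms in \<open>auto elim!: PlusE\<close>)
  then show ?thesis using fin by (simp add: sum.Plus comp_def)
qed

text \<open>The first-layer bin is a triple: \<open>k0\<close> travels on the common link,
  \<open>k1\<close> and \<open>k2\<close> on the private ones. Receiver 1 lacks only
  \<open>k2\<close>, so \<open>card K / L2 = L0 * L1\<close> bins are effective for it, and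
  symmetrically for receiver 2. The private links also carry the second-layer bins,
  \<open>M1\<close> and \<open>M2\<close> in number. Each layer costs one factor
  \<open>1 + \<eta>\<close>. The bound is on the sum of the two success masses, since one choice of
  first-layer clocks has to suit both receivers.\<close>

lemma one_shot_code:
  fixes P :: "'w \<Rightarrow> real" and p0 :: "'s \<Rightarrow> 'a0 \<Rightarrow> real"
    and p1 :: "'s \<Rightarrow> 'a0 \<Rightarrow> 'a1 \<Rightarrow> real" and p2 :: "'s \<Rightarrow> 'a0 \<Rightarrow> 'a2 \<Rightarrow> real"
    and d1 :: "'t1 \<Rightarrow> 'a0 \<Rightarrow> real" and d2 :: "'t2 \<Rightarrow> 'a0 \<Rightarrow> real"
    and e1 :: "'t1 \<Rightarrow> 'a0 \<Rightarrow> 'a1 \<Rightarrow> real" and e2 :: "'t2 \<Rightarrow> 'a0 \<Rightarrow> 'a2 \<Rightarrow> real"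
    and L0 L1 L2 M1 M2 :: nat
  assumes fin: "finite W" "finite A0" "finite A1" "finite A2" and eta: "0 \<le> \<eta>"
    and pos: "L0 > 0" "L1 > 0" "L2 > 0" "M1 > 0" "M2 > 0"
    and P: "\<And>w. w \<in> W \<Longrightarrow> 0 \<le> P w"
    and c0: "\<And>w a. w \<in> W \<Longrightarrow> a \<in> A0 \<Longrightarrow> 0 \<le> p0 (x w) a" "\<And>w. w \<in> W \<Longrightarrow> sum (p0 (x w)) A0 \<le> 1"
      "\<And>w a. w \<in> W \<Longrightarrow> a \<in> A0 \<Longrightarrow> 0 \<le> d1 (y1 w) a" "\<And>w. w \<in> W \<Longrightarrow> sum (d1 (y1 w)) A0 \<le> 1"
      "\<And>w a. w \<in> W \<Longrightarrow> a \<in> A0 \<Longrightarrow> 0 \<le> d2 (y2 w) a" "\<And>w. w \<in> W \<Longrightarrow> sum (d2 (y2 w)) A0 \<le> 1"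
    and c1: "\<And>w a b. w \<in> W \<Longrightarrow> a \<in> A0 \<Longrightarrow> b \<in> A1 \<Longrightarrow> 0 \<le> p1 (x w) a b"
      "\<And>w a b. w \<in> W \<Longrightarrow> a \<in> A0 \<Longrightarrow> b \<in> A1 \<Longrightarrow> 0 \<le> e1 (y1 w) a b"
      "\<And>w a. w \<in> W \<Longrightarrow> a \<in> A0 \<Longrightarrow> sum (p1 (x w) a) A1 \<le> 1"
      "\<And>w a. w \<in> W \<Longrightarrow> a \<in> A0 \<Longrightarrow> sum (e1 (y1 w) a) A1 \<le> 1"
    and c2: "\<And>w a b. w \<in> W \<Longrightarrow> a \<in> A0 \<Longrightarrow> b \<in> A2 \<Longrightarrow> 0 \<le> p2 (x w) a b"
      "\<And>w a b. w \<in> W \<Longrightarrow> a \<in> A0 \<Longrightarrow> b \<in> A2 \<Longrightarrow> 0 \<le> e2 (y2 w) a b"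
      "\<And>w a. w \<in> W \<Longrightarrow> a \<in> A0 \<Longrightarrow> sum (p2 (x w) a) A2 \<le> 1"
      "\<And>w a. w \<in> W \<Longrightarrow> a \<in> A0 \<Longrightarrow> sum (e2 (y2 w) a) A2 \<le> 1"
    and T1: "T1 \<subseteq> W \<times> A0 \<times> A1"
      "\<And>w a b. (w, a, b) \<in> T1 \<Longrightarrow> p0 (x w) a \<le> \<eta> * (real L0 * real L1) * d1 (y1 w) a"
      "\<And>w a b. (w, a, b) \<in> T1 \<Longrightarrow> p1 (x w) a b \<le> \<eta> * real M1 * e1 (y1 w) a b"
    and T2: "T2 \<subseteq> W \<times> A0 \<times> A2"
      "\<And>w a b. (w, a, b) \<in> T2 \<Longrightarrow> p0 (x w) a \<le> \<eta> * (real L0 * real L2) * d2 (y2 w) a"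
      "\<And>w a b. (w, a, b) \<in> T2 \<Longrightarrow> p2 (x w) a b \<le> \<eta> * real M2 * e2 (y2 w) a b"
  shows "\<exists>enc dec1 dec2. (\<forall>s. enc s \<in> {1..L0} \<times> {1..L1 * M1} \<times> {1..L2 * M2}) \<and>
    ((\<Sum>(w, a, b)\<in>T1. P w * p0 (x w) a * p1 (x w) a b) + (\<Sum>(w, a, b)\<in>T2. P w * p0 (x w) a * p2 (x w) a b)) / (1 + \<eta>)\<^sup>2
    \<le> (\<Sum>w | w \<in> W \<and> (\<exists>a. (w, a, dec1 (fst (enc (x w))) (fst (snd (enc (x w)))) (y1 w)) \<in> T1). P w) +
      (\<Sum>w | w \<in> W \<and> (\<exists>a. (w, a, dec2 (fst (enc (x w))) (snd (snd (enc (x w)))) (y2 w)) \<in> T2). P w)"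
proof -
  define K where "K = {..<L0} \<times> {..<L1} \<times> {..<L2}"
  have finK: "finite K" "K \<noteq> {}" and cardK: "card K = L0 * (L1 * L2)"
    using pos by (auto simp: K_def)
  \<comment> \<open>What each receiver learns about the bin. Fixing \<open>h1 k\<close> leaves only
    \<open>k2\<close> free and fixing \<open>h2 k\<close> only \<open>k1\<close>, hence the class
    sizes \<open>L2\<close> and \<open>L1\<close>.\<close>
  define h1 h2 :: "nat \<times> nat \<times> nat \<Rightarrow> nat \<times> nat"
    where h: "h1 = (\<lambda>(k0, k1, k2). (k0, k1))" "h2 = (\<lambda>(k0, k1, k2). (k0, k2))"
  have N1: "card {k' \<in> K. h1 k' = h1 k} \<le> L2" for k
  proof -
    have "{k' \<in> K. h1 k' = h1 k} \<subseteq> (\<lambda>j. (fst (h1 k), snd (h1 k), j)) ` {..<L2}"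
      by (cases k) (auto simp: K_def h)
    from surj_card_le[OF _ this] show ?thesis by simp
  qed
  have N2: "card {k' \<in> K. h2 k' = h2 k} \<le> L1" for k
  proof -
    have "{k' \<in> K. h2 k' = h2 k} \<subseteq> (\<lambda>j. (fst (h2 k), j, snd (h2 k))) ` {..<L1}"
      by (cases k) (auto simp: K_def h)
    from surj_card_le[OF _ this] show ?thesis by simp
  qed
  have finT: "finite T1" "finite T2" using T1 T2 fin by (auto intro: finite_subset)
  have "\<exists>\<omega>. ((\<Sum>i\<in>T1. (P (fst i) * p1 (x (fst i)) (fst (snd i)) (snd (snd i))) * p0 (x (fst i)) (fst (snd i))) +
      (\<Sum>i\<in>T2. (P (fst i) * p2 (x (fst i)) (fst (snd i)) (snd (snd i))) * p0 (x (fst i)) (fst (snd i)))) / (1 + \<eta>) \<le>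
    (\<Sum>i\<in>T1. \<Sum>k\<in>K. (P (fst i) * p1 (x (fst i)) (fst (snd i)) (snd (snd i))) *
       of_bool (wins_race (A0 \<times> K) \<omega> (binned (card K) (p0 (x (fst i)))) (fst (snd i), k) \<and>
       wins_race (A0 \<times> K) \<omega> (binned_at h1 (h1 k) L2 (d1 (y1 (fst i)))) (fst (snd i), k))) +
    (\<Sum>i\<in>T2. \<Sum>k\<in>K. (P (fst i) * p2 (x (fst i)) (fst (snd i)) (snd (snd i))) *
       of_bool (wins_race (A0 \<times> K) \<omega> (binned (card K) (p0 (x (fst i)))) (fst (snd i), k) \<and>
       wins_race (A0 \<times> K) \<omega> (binned_at h2 (h2 k) L1 (d2 (y2 (fst i)))) (fst (snd i), k)))"
  proof (rule exists_binned_race_clocks_pair)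
    fix i assume "i \<in> T1"
    then have i: "fst i \<in> W" "fst (snd i) \<in> A0" "snd (snd i) \<in> A1" "(fst i, fst (snd i), snd (snd i)) \<in> T1"
      using T1(1) by auto
    show "fst (snd i) \<in> A0" by fact
    show "0 \<le> P (fst i) * p1 (x (fst i)) (fst (snd i)) (snd (snd i))" using i P c1 by simp
    show "sum (p0 (x (fst i))) A0 \<le> 1" "sum (d1 (y1 (fst i))) A0 \<le> 1" using i c0 by auto
    have "p0 (x (fst i)) (fst (snd i)) * real L2 \<le> \<eta> * (real L0 * real L1) * d1 (y1 (fst i)) (fst (snd i)) * real L2"
      by (intro mult_right_mono T1(2)[OF i(4)]) simp
    then show "p0 (x (fst i)) (fst (snd i)) * real L2 \<le> \<eta> * real (card K) * d1 (y1 (fst i)) (fst (snd i))"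
      by (simp add: cardK mult_ac)
    fix a assume "a \<in> A0" then show "0 \<le> p0 (x (fst i)) a" "0 \<le> d1 (y1 (fst i)) a" using i c0 by auto
  next
    fix i assume "i \<in> T2"
    then have i: "fst i \<in> W" "fst (snd i) \<in> A0" "snd (snd i) \<in> A2" "(fst i, fst (snd i), snd (snd i)) \<in> T2"
      using T2(1) by auto
    show "fst (snd i) \<in> A0" by fact
    show "0 \<le> P (fst i) * p2 (x (fst i)) (fst (snd i)) (snd (snd i))" using i P c2 by simp
    show "sum (p0 (x (fst i))) A0 \<le> 1" "sum (d2 (y2 (fst i))) A0 \<le> 1" using i c0 by auto
    have "p0 (x (fst i)) (fst (snd i)) * real L1 \<le> \<eta> * (real L0 * real L2) * d2 (y2 (fst i)) (fst (snd i)) * real L1"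
      by (intro mult_right_mono T2(2)[OF i(4)]) simp
    then show "p0 (x (fst i)) (fst (snd i)) * real L1 \<le> \<eta> * real (card K) * d2 (y2 (fst i)) (fst (snd i))"
      by (simp add: cardK mult_ac)
    fix a assume "a \<in> A0" then show "0 \<le> p0 (x (fst i)) a" "0 \<le> d2 (y2 (fst i)) a" using i c0 by auto
  qed (use fin finT finK N1 N2 eta pos in auto)
  then obtain \<omega>0 where \<omega>0: "((\<Sum>(w, a, b)\<in>T1. P w * p0 (x w) a * p1 (x w) a b) + (\<Sum>(w, a, b)\<in>T2. P w * p0 (x w) a * p2 (x w) a b)) / (1 + \<eta>) \<le>
    (\<Sum>(w, a, b)\<in>T1. \<Sum>k\<in>K. P w * p1 (x w) a b *
        of_bool (wins_race (A0 \<times> K) \<omega>0 (binned (card K) (p0 (x w))) (a, k) \<and>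
           wins_race (A0 \<times> K) \<omega>0 (binned_at h1 (h1 k) L2 (d1 (y1 w))) (a, k))) +
    (\<Sum>(w, a, b)\<in>T2. \<Sum>k\<in>K. P w * p2 (x w) a b *
        of_bool (wins_race (A0 \<times> K) \<omega>0 (binned (card K) (p0 (x w))) (a, k) \<and>
           wins_race (A0 \<times> K) \<omega>0 (binned_at h2 (h2 k) L1 (d2 (y2 w))) (a, k)))"
    (is "_ \<le> ?X1 + ?X2")
    by (auto simp: case_prod_unfold mult_ac)
  let ?v0 = "\<lambda>s. race_winner (A0 \<times> K) \<omega>0 (binned (card K) (p0 s))"
  \<comment> \<open>The second-layer clocks can be optimised separately, as each vector concerns
    only one receiver.\<close>
  obtain \<omega>1 where \<omega>1: "?X1 / (1 + \<eta>) \<le> (\<Sum>w | w \<in> W \<and> (\<exists>a b k m. (w, a, b) \<in> T1 \<and> k \<in> K \<and> m < M1 \<and>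
        ?v0 (x w) = (a, k) \<and>
        race_winner (A0 \<times> K) \<omega>0 (binned_at h1 (h1 k) L2 (d1 (y1 w))) = (a, k) \<and>
        race_winner (A1 \<times> {..<M1}) \<omega>1 (binned M1 (p1 (x w) a)) = (b, m) \<and>
        race_winner (A1 \<times> {..<M1}) \<omega>1 (binned_at id m 1 (e1 (y1 w) a)) = (b, m)). P w)"
    (is "_ \<le> sum P ?S1")
    using satellite_success[where x = x and y = y1 and ?p1.0 = p1 and ?e1.0 = e1 and W = W and P = P and T = T1
        and h = h1 and d = d1 and N = L2 and ?p0.0 = p0 and ?\<omega>0.0 = \<omega>0,
        OF fin(1-3) finK(1) eta pos(4) P c1 T1(1,3)] by blast
  obtain \<omega>2 where \<omega>2: "?X2 / (1 + \<eta>) \<le> (\<Sum>w | w \<in> W \<and> (\<exists>a b k m. (w, a, b) \<in> T2 \<and> k \<in> K \<and> m < M2 \<and>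
        ?v0 (x w) = (a, k) \<and>
        race_winner (A0 \<times> K) \<omega>0 (binned_at h2 (h2 k) L1 (d2 (y2 w))) = (a, k) \<and>
        race_winner (A2 \<times> {..<M2}) \<omega>2 (binned M2 (p2 (x w) a)) = (b, m) \<and>
        race_winner (A2 \<times> {..<M2}) \<omega>2 (binned_at id m 1 (e2 (y2 w) a)) = (b, m)). P w)"
    (is "_ \<le> sum P ?S2")
    using satellite_success[where x = x and y = y2 and ?p1.0 = p2 and ?e1.0 = e2 and W = W and P = P and T = T2
        and h = h2 and d = d2 and N = L1 and ?p0.0 = p0 and ?\<omega>0.0 = \<omega>0,
        OF fin(1,2,4) finK(1) eta pos(5) P c2 T2(1,3)] by blast
  \<comment> \<open>Keeps the encoder within its range even where a race has no winner; on
    successful outcomes it changes nothing.\<close>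
  define clip :: "nat \<Rightarrow> nat \<Rightarrow> nat" where "clip L k = (if k \<in> {1..L} then k else 1)" for L k
  \<comment> \<open>A private message packs \<open>k1\<close> and the second-layer bin
    \<open>m\<close> as \<open>k1 * M1 + m\<close>, shifted by 1 because message sets start at 1.
    The decoders subtract 1 and unpack by \<open>div\<close> and \<open>mod\<close>.\<close>
  define enc where "enc s = (case ?v0 s of (a, k0, k1, k2) \<Rightarrow>
     (clip L0 (k0 + 1),
      clip (L1 * M1) (k1 * M1 + snd (race_winner (A1 \<times> {..<M1}) \<omega>1 (binned M1 (p1 s a))) + 1),
      clip (L2 * M2) (k2 * M2 + snd (race_winner (A2 \<times> {..<M2}) \<omega>2 (binned M2 (p2 s a))) + 1)))" for s
  define dec1 where "dec1 k0 k1 y = (let a = fst (race_winner (A0 \<times> K) \<omega>0 (binned_at h1 (k0 - 1, (k1 - 1) div M1) L2 (d1 y)))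
     in fst (race_winner (A1 \<times> {..<M1}) \<omega>1 (binned_at id ((k1 - 1) mod M1) 1 (e1 y a))))" for k0 k1 y
  define dec2 where "dec2 k0 k1 y = (let a = fst (race_winner (A0 \<times> K) \<omega>0 (binned_at h2 (k0 - 1, (k1 - 1) div M2) L1 (d2 y)))
     in fst (race_winner (A2 \<times> {..<M2}) \<omega>2 (binned_at id ((k1 - 1) mod M2) 1 (e2 y a))))" for k0 k1 y
  have clip: "clip L k \<in> {1..L}" if "L > 0" for L k using that by (auto simp: clip_def)
  have enc: "enc s \<in> {1..L0} \<times> {1..L1 * M1} \<times> {1..L2 * M2}" for s
    using clip pos by (auto simp: enc_def split: prod.splits)
  have rng: "k * M + m + 1 \<in> {1..L * M}" if "k < L" "m < M" for k m L M :: nat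
  proof -
    have "k * M + m + 1 \<le> (k + 1) * M" using that by simp
    also have "\<dots> \<le> L * M" using that by (intro mult_le_mono1) simp
    finally show ?thesis by simp
  qed
  have S1: "?S1 \<subseteq> {w \<in> W. \<exists>a. (w, a, dec1 (fst (enc (x w))) (fst (snd (enc (x w)))) (y1 w)) \<in> T1}"
  proof
    fix w assume "w \<in> ?S1"
    then obtain a b k0 k1 k2 m where
      *: "w \<in> W" "(w, a, b) \<in> T1" "(k0, k1, k2) \<in> K" "m < M1" "?v0 (x w) = (a, k0, k1, k2)"
        "race_winner (A0 \<times> K) \<omega>0 (binned_at h1 (h1 (k0, k1, k2)) L2 (d1 (y1 w))) = (a, k0, k1, k2)"
        "race_winner (A1 \<times> {..<M1}) \<omega>1 (binned M1 (p1 (x w) a)) = (b, m)"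
        "race_winner (A1 \<times> {..<M1}) \<omega>1 (binned_at id m 1 (e1 (y1 w) a)) = (b, m)"
      by auto
    have k: "k0 < L0" "k1 < L1" using * by (auto simp: K_def)
    have "fst (enc (x w)) = k0 + 1" "fst (snd (enc (x w))) = k1 * M1 + m + 1"
      using * k rng[OF k(2) *(4)] by (auto simp: enc_def clip_def)
    then have "dec1 (fst (enc (x w))) (fst (snd (enc (x w)))) (y1 w) = b"
      using * by (simp add: dec1_def Let_def h)
    with * show "w \<in> {w \<in> W. \<exists>a. (w, a, dec1 (fst (enc (x w))) (fst (snd (enc (x w)))) (y1 w)) \<in> T1}" by auto
  qed
  have S2: "?S2 \<subseteq> {w \<in> W. \<exists>a. (w, a, dec2 (fst (enc (x w))) (snd (snd (enc (x w)))) (y2 w)) \<in> T2}"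
  proof
    fix w assume "w \<in> ?S2"
    then obtain a b k0 k1 k2 m where
      *: "w \<in> W" "(w, a, b) \<in> T2" "(k0, k1, k2) \<in> K" "m < M2" "?v0 (x w) = (a, k0, k1, k2)"
        "race_winner (A0 \<times> K) \<omega>0 (binned_at h2 (h2 (k0, k1, k2)) L1 (d2 (y2 w))) = (a, k0, k1, k2)"
        "race_winner (A2 \<times> {..<M2}) \<omega>2 (binned M2 (p2 (x w) a)) = (b, m)"
        "race_winner (A2 \<times> {..<M2}) \<omega>2 (binned_at id m 1 (e2 (y2 w) a)) = (b, m)"
      by auto
    have k: "k0 < L0" "k2 < L2" using * by (auto simp: K_def)
    have "fst (enc (x w)) = k0 + 1" "snd (snd (enc (x w))) = k2 * M2 + m + 1"
      using * k rng[OF k(2) *(4)] by (auto simp: enc_def clip_def)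
    then have "dec2 (fst (enc (x w))) (snd (snd (enc (x w)))) (y2 w) = b"
      using * by (simp add: dec2_def Let_def h)
    with * show "w \<in> {w \<in> W. \<exists>a. (w, a, dec2 (fst (enc (x w))) (snd (snd (enc (x w)))) (y2 w)) \<in> T2}" by auto
  qed
  \<comment> \<open>One factor \<open>1 + \<eta>\<close> is spent on \<open>\<omega>0\<close>, the
    other on \<open>\<omega>1\<close> and \<open>\<omega>2\<close>.\<close>
  have "((\<Sum>(w, a, b)\<in>T1. P w * p0 (x w) a * p1 (x w) a b) + (\<Sum>(w, a, b)\<in>T2. P w * p0 (x w) a * p2 (x w) a b)) / (1 + \<eta>)\<^sup>2
    \<le> (?X1 + ?X2) / (1 + \<eta>)"
    unfolding power2_eq_square divide_divide_eq_left[symmetric]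
    using eta by (intro divide_right_mono[OF \<omega>0]) simp
  also have "\<dots> \<le> sum P ?S1 + sum P ?S2" using \<omega>1 \<omega>2 by (simp add: add_divide_distrib)
  also have "\<dots> \<le> (\<Sum>w | w \<in> W \<and> (\<exists>a. (w, a, dec1 (fst (enc (x w))) (fst (snd (enc (x w)))) (y1 w)) \<in> T1). P w) +
      (\<Sum>w | w \<in> W \<and> (\<exists>a. (w, a, dec2 (fst (enc (x w))) (snd (snd (enc (x w)))) (y2 w)) \<in> T2). P w)"
    by (intro add_mono sum_mono2 S1 S2) (use fin P in auto)
  finally show ?thesis using enc by blast
qed

section \<open>Words and the weak law of large numbers\<close>

definition words :: "nat \<Rightarrow> 'a set \<Rightarrow> 'a list set" where
  "words n A = {xs. set xs \<subseteq> A \<and> length xs = n}"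

lemma finite_words [simp]: "finite A \<Longrightarrow> finite (words n A)"
  unfolding words_def by (rule finite_lists_length_eq)

lemma words_0 [simp]: "words 0 A = {[]}"
  by (auto simp: words_def)

lemma length_words: "xs \<in> words n A \<Longrightarrow> length xs = n"
  by (simp add: words_def)

lemma sum_words_Suc: "(\<Sum>xs\<in>words (Suc n) A. F xs) = (\<Sum>a\<in>A. \<Sum>xs\<in>words n A. F (a # xs))"
proof -
  have "words (Suc n) A = (\<lambda>(a, xs). a # xs) ` (A \<times> words n A)"
    by (auto simp: words_def image_iff length_Suc_conv)
  moreover have "inj_on (\<lambda>(a, xs). a # xs) (A \<times> words n A)" by (auto simp: inj_on_def)
  ultimately show ?thesis by (simp add: sum.reindex sum.cartesian_product case_prod_unfold)
qed

lemma sum_words_prod_list_map2: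
  fixes f :: "'a \<Rightarrow> 'b \<Rightarrow> 'c::comm_semiring_1"
  shows "(\<Sum>vs\<in>words (length xs) A. prod_list (map2 f xs vs)) = prod_list (map (\<lambda>x. \<Sum>a\<in>A. f x a) xs)"
  by (induction xs) (simp_all add: sum_words_Suc sum_distrib_left[symmetric] sum_distrib_right[symmetric])

lemma prod_list_le_one:
  "(\<And>x. x \<in> set xs \<Longrightarrow> 0 \<le> x \<and> x \<le> 1) \<Longrightarrow> prod_list (xs :: real list) \<le> 1"
  by (induction xs) (auto intro!: mult_le_one prod_list_nonneg)

definition iid_weight :: "('a \<Rightarrow> real) \<Rightarrow> 'a list \<Rightarrow> real" where
  "iid_weight g zs = prod_list (map g zs)"

lemma iid_weight_simps [simp]:
  "iid_weight g [] = 1" "iid_weight g (z # zs) = g z * iid_weight g zs"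
  by (simp_all add: iid_weight_def)

lemma iid_weight_nonneg: "(\<And>z. 0 \<le> g z) \<Longrightarrow> 0 \<le> iid_weight g zs"
  by (auto simp: iid_weight_def intro!: prod_list_nonneg)

lemma sum_iid_weight:
  "(\<Sum>z\<in>S. g z) = 1 \<Longrightarrow> (\<Sum>zs\<in>words n S. iid_weight g zs) = 1"
  by (induction n) (simp_all add: sum_words_Suc sum_distrib_left[symmetric])

lemma sum_iid_weight_first_moment:
  assumes "(\<Sum>z\<in>S. g z) = 1" "(\<Sum>z\<in>S. g z * f z) = 0"
  shows "(\<Sum>zs\<in>words n S. iid_weight g zs * sum_list (map f zs)) = 0"
proof (induction n)
  case (Suc n)
  have "(\<Sum>zs\<in>words (Suc n) S. iid_weight g zs * sum_list (map f zs)) =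
    (\<Sum>z\<in>S. (g z * f z) * (\<Sum>zs\<in>words n S. iid_weight g zs) +
       g z * (\<Sum>zs\<in>words n S. iid_weight g zs * sum_list (map f zs)))"
    by (simp add: sum_words_Suc sum_distrib_left sum.distrib[symmetric] algebra_simps)
  also have "\<dots> = 0" using Suc assms by (simp add: sum_iid_weight)
  finally show ?case .
qed simp

text \<open>Split off the first letter \<open>z\<close> and let \<open>s\<close> be the sum over the
  rest. In the expansion of \<open>(f z + s)\<^sup>2\<close> the cross term has mean 0, because
  \<open>f\<close> is centred, and so variances add.\<close>

lemma sum_iid_weight_second_moment:
  assumes "(\<Sum>z\<in>S. g z) = 1" "(\<Sum>z\<in>S. g z * f z) = 0"
  shows "(\<Sum>zs\<in>words n S. iid_weight g zs * (sum_list (map f zs))\<^sup>2) = real n * (\<Sum>z\<in>S. g z * (f z)\<^sup>2)"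
proof (induction n)
  case (Suc n)
  have "(\<Sum>zs\<in>words (Suc n) S. iid_weight g zs * (sum_list (map f zs))\<^sup>2) =
    (\<Sum>z\<in>S. (g z * (f z)\<^sup>2) * (\<Sum>zs\<in>words n S. iid_weight g zs) +
       2 * (g z * f z) * (\<Sum>zs\<in>words n S. iid_weight g zs * sum_list (map f zs)) +
       g z * (\<Sum>zs\<in>words n S. iid_weight g zs * (sum_list (map f zs))\<^sup>2))"
    by (simp add: sum_words_Suc sum_distrib_left sum.distrib[symmetric] algebra_simps power2_eq_square)
  also have "\<dots> = (\<Sum>z\<in>S. g z * (f z)\<^sup>2) + (\<Sum>z\<in>S. g z) * (real n * (\<Sum>z\<in>S. g z * (f z)\<^sup>2))"
    using sum_iid_weight_first_moment[OF assms] sum_iid_weight[OF assms(1)] Suc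
    by (simp add: sum.distrib sum_distrib_right)
  also have "\<dots> = real (Suc n) * (\<Sum>z\<in>S. g z * (f z)\<^sup>2)"
    using assms by (simp add: algebra_simps)
  finally show ?case .
qed simp

text \<open>Chebyshev's inequality: the centred sum has second moment \<open>real n * V\<close>, and
  division by \<open>(real n * \<delta>)\<^sup>2\<close> leaves a bound of order
  \<open>1 / n\<close>.\<close>

lemma weak_law_of_large_numbers:
  fixes f g :: "'a \<Rightarrow> real"
  assumes "finite S" "\<And>z. 0 \<le> g z" "(\<Sum>z\<in>S. g z) = 1" and \<mu>: "\<mu> = (\<Sum>z\<in>S. g z * f z)" and "0 < \<delta>"
  shows "(\<lambda>n. \<Sum>zs | zs \<in> words n S \<and> \<bar>sum_list (map f zs) - real n * \<mu>\<bar> > real n * \<delta>. iid_weight g zs) \<longlonglongrightarrow> 0"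
proof -
  define V where "V = (\<Sum>z\<in>S. g z * (f z - \<mu>)\<^sup>2)"
  have centred: "(\<Sum>z\<in>S. g z * (f z - \<mu>)) = 0"
    using assms(3) by (simp add: right_diff_distrib sum_subtractf sum_distrib_right[symmetric] \<mu>)
  have "(\<Sum>zs | zs \<in> words n S \<and> \<bar>sum_list (map f zs) - real n * \<mu>\<bar> > real n * \<delta>. iid_weight g zs) \<le> V / \<delta>\<^sup>2 / real n"
    (is "sum _ ?B \<le> _") if n: "n > 0" for n
  proof -
    have s: "sum_list (map (\<lambda>z. f z - \<mu>) zs) = sum_list (map f zs) - real n * \<mu>" if "zs \<in> words n S" for zs
      using length_words[OF that] by (simp add: sum_list_subtractf sum_list_triv)
    have "(real n * \<delta>)\<^sup>2 * (\<Sum>zs\<in>?B. iid_weight g zs) \<le> (\<Sum>zs\<in>?B. iid_weight g zs * (sum_list (map (\<lambda>z. f z - \<mu>) zs))\<^sup>2)"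
      unfolding sum_distrib_left
    proof (intro sum_mono)
      fix zs assume zs: "zs \<in> ?B"
      then have "(real n * \<delta>)\<^sup>2 \<le> (sum_list (map (\<lambda>z. f z - \<mu>) zs))\<^sup>2"
        using s assms(5) by (subst abs_le_square_iff[symmetric]) auto
      then show "(real n * \<delta>)\<^sup>2 * iid_weight g zs \<le> iid_weight g zs * (sum_list (map (\<lambda>z. f z - \<mu>) zs))\<^sup>2"
        using iid_weight_nonneg[of g zs] assms by (metis mult.commute mult_left_mono)
    qed
    also have "\<dots> \<le> (\<Sum>zs\<in>words n S. iid_weight g zs * (sum_list (map (\<lambda>z. f z - \<mu>) zs))\<^sup>2)"
      using assms by (intro sum_mono2) (auto intro!: mult_nonneg_nonneg iid_weight_nonneg)
    also have "\<dots> = real n * V"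
      unfolding V_def using assms(3) centred by (rule sum_iid_weight_second_moment)
    finally show ?thesis using n assms(5) by (simp add: field_simps power2_eq_square)
  qed
  then have le: "\<forall>\<^sub>F n in sequentially. (\<Sum>zs | zs \<in> words n S \<and> \<bar>sum_list (map f zs) - real n * \<mu>\<bar> > real n * \<delta>. iid_weight g zs) \<le> V / \<delta>\<^sup>2 / real n"
    by (rule eventually_mono[OF eventually_gt_at_top[of 0]])
  show ?thesis
  proof (rule tendsto_sandwich[of "\<lambda>_. 0", OF _ le])
    show "(\<lambda>n. V / \<delta>\<^sup>2 / real n) \<longlonglongrightarrow> 0" by (rule lim_const_over_n)
  qed (use assms in \<open>auto intro!: sum_nonneg iid_weight_nonneg always_eventually\<close>)
qed

lemma sum_split_pred:
  "finite X \<Longrightarrow> sum g X = (\<Sum>z | z \<in> X \<and> Q z. g z) + (\<Sum>z | z \<in> X \<and> \<not> Q z. g z)"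
  by (subst sum.union_disjoint[symmetric]) (auto intro!: sum.cong)

text \<open>The union bound, with \<open>C\<close> indexing the exceptional events.\<close>

lemma sum_finite_cover_le:
  fixes g :: "'a \<Rightarrow> real"
  assumes "finite C" "finite X" "\<And>z. 0 \<le> g z" "\<And>z. z \<in> X \<Longrightarrow> B z \<Longrightarrow> \<exists>c\<in>C. D c z"
  shows "(\<Sum>z | z \<in> X \<and> B z. g z) \<le> (\<Sum>c\<in>C. \<Sum>z | z \<in> X \<and> D c z. g z)"
proof -
  have "(\<Sum>z | z \<in> X \<and> B z. g z) \<le> sum g (\<Union>c\<in>C. {z. z \<in> X \<and> D c z})"
    using assms by (intro sum_mono2) auto
  also have "\<dots> \<le> (\<Sum>c\<in>C. \<Sum>z | z \<in> X \<and> D c z. g z)"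
    using assms(1)
  proof (induction C)
    case (insert c C)
    have "sum g (\<Union>c\<in>insert c C. {z. z \<in> X \<and> D c z}) \<le> sum g {z. z \<in> X \<and> D c z} + sum g (\<Union>c\<in>C. {z. z \<in> X \<and> D c z})"
      using sum_Un[of "{z. z \<in> X \<and> D c z}" "\<Union>c\<in>C. {z. z \<in> X \<and> D c z}" g]
        sum_nonneg[of "{z. z \<in> X \<and> D c z} \<inter> (\<Union>c\<in>C. {z. z \<in> X \<and> D c z})" g] assms insert(1) by simp
    then show ?case using insert by simp
  qed simp
  finally show ?thesis .
qed

text \<open>The weak law for each statistic, combined by the union bound. Tolerances depend on the
  statistic because letter frequencies and information densities are to be controlled
  together.\<close>

lemma all_empirical_means_converge:
  fixes f :: "'c \<Rightarrow> 'a \<Rightarrow> real"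
  assumes "finite S" "\<And>z. 0 \<le> g z" "(\<Sum>z\<in>S. g z) = 1" "finite C" "\<And>c. c \<in> C \<Longrightarrow> 0 < \<delta> c"
  shows "(\<lambda>n. \<Sum>zs | zs \<in> words n S \<and>
      (\<forall>c\<in>C. \<bar>sum_list (map (f c) zs) - real n * (\<Sum>z\<in>S. g z * f c z)\<bar> \<le> real n * \<delta> c). iid_weight g zs) \<longlonglongrightarrow> 1"
proof -
  let ?bad = "\<lambda>n c zs. \<bar>sum_list (map (f c) zs) - real n * (\<Sum>z\<in>S. g z * f c z)\<bar> > real n * \<delta> c"
  let ?good = "\<lambda>n zs. (\<forall>c\<in>C. \<bar>sum_list (map (f c) zs) - real n * (\<Sum>z\<in>S. g z * f c z)\<bar> \<le> real n * \<delta> c)"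
  have lim: "(\<lambda>n. 1 - (\<Sum>c\<in>C. \<Sum>zs | zs \<in> words n S \<and> ?bad n c zs. iid_weight g zs)) \<longlonglongrightarrow> 1 - (\<Sum>c\<in>C. 0)"
    using assms by (intro tendsto_diff tendsto_const tendsto_sum weak_law_of_large_numbers) auto
  show ?thesis
  proof (rule tendsto_sandwich[OF always_eventually always_eventually])
    show "(\<lambda>n. 1 - (\<Sum>c\<in>C. \<Sum>zs | zs \<in> words n S \<and> ?bad n c zs. iid_weight g zs)) \<longlonglongrightarrow> 1" using lim by simp
    have split: "1 = (\<Sum>zs | zs \<in> words n S \<and> ?good n zs. iid_weight g zs) + (\<Sum>zs | zs \<in> words n S \<and> \<not> ?good n zs. iid_weight g zs)" for n
      unfolding sum_iid_weight[OF assms(3), of n, symmetric] using assms(1) by (intro sum_split_pred) simp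
    show "\<forall>n. 1 - (\<Sum>c\<in>C. \<Sum>zs | zs \<in> words n S \<and> ?bad n c zs. iid_weight g zs) \<le> (\<Sum>zs | zs \<in> words n S \<and> ?good n zs. iid_weight g zs)"
    proof
      fix n
      have "(\<Sum>zs | zs \<in> words n S \<and> \<not> ?good n zs. iid_weight g zs) \<le> (\<Sum>c\<in>C. \<Sum>zs | zs \<in> words n S \<and> ?bad n c zs. iid_weight g zs)"
        using assms by (intro sum_finite_cover_le) (auto intro!: iid_weight_nonneg simp: not_le)
      then show "1 - (\<Sum>c\<in>C. \<Sum>zs | zs \<in> words n S \<and> ?bad n c zs. iid_weight g zs) \<le> (\<Sum>zs | zs \<in> words n S \<and> ?good n zs. iid_weight g zs)"
        using split[of n] by linarith
    qed
    show "\<forall>n. (\<Sum>zs | zs \<in> words n S \<and> ?good n zs. iid_weight g zs) \<le> 1"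
    proof
      fix n
      have "0 \<le> (\<Sum>zs | zs \<in> words n S \<and> \<not> ?good n zs. iid_weight g zs)"
        using assms by (intro sum_nonneg iid_weight_nonneg) auto
      then show "(\<Sum>zs | zs \<in> words n S \<and> ?good n zs. iid_weight g zs) \<le> 1"
        using split[of n] by linarith
    qed
  qed simp
qed

text \<open>A letter frequency is the empirical mean of an indicator, which brings typicality under
  the weak law.\<close>

lemma emp_eq_sum_list: "emp zs a = sum_list (map (\<lambda>z. of_bool (z = a)) zs) / real (length zs)"
proof -
  have "sum_list (map (\<lambda>z. of_bool (z = a) :: real) zs) = real (length (filter (\<lambda>z. z = a) zs))"
    by (induction zs) auto
  then show ?thesis by (simp add: emp_def length_filter_conv_card)
qed

section \<open>Conditional mutual information\<close>

lemma Ent_map_pmf: "Ent (map_pmf h J) f = Ent J (\<lambda>z. f (h z))"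
  by (simp add: Ent_def pmf.map_comp comp_def)

lemma cmi_map_pmf: "cmi (map_pmf h J) A B C = cmi J (\<lambda>z. A (h z)) (\<lambda>z. B (h z)) (\<lambda>z. C (h z))"
  by (simp add: cmi_def Ent_map_pmf)

lemma Ent_inj:
  assumes "\<And>z. f z = h (g z)" "inj h"
  shows "Ent J f = Ent J g"
proof -
  have "f = (\<lambda>z. h (g z))" using assms(1) by blast
  then have "map_pmf f J = map_pmf h (map_pmf g J)" by (simp add: pmf.map_comp comp_def)
  moreover have "entropy_pmf (map_pmf h p) = entropy_pmf p" for p
    using assms(2) by (simp add: entropy_pmf_def sum.reindex inj_on_subset[OF assms(2)] pmf_map_inj')
  ultimately show ?thesis by (simp add: Ent_def)
qed

text \<open>Written with entropies the right side telescopes: those of \<open>(X, V, Y)\<close> and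
  \<open>(V, Y)\<close> cancel. What remains differs from the left side only in the bracketing and
  order of tuples.\<close>

lemma cmi_chain:
  "cmi J X (\<lambda>w. (V w, V' w)) Y = cmi J X V Y + cmi J X V' (\<lambda>w. (V w, Y w))"
proof -
  have "Ent J (\<lambda>w. ((V w, V' w), Y w)) = Ent J (\<lambda>w. (V' w, V w, Y w))"
    by (rule Ent_inj[where h = "\<lambda>(b, a, c). ((a, b), c)"]) (auto simp: inj_def)
  moreover have "Ent J (\<lambda>w. (X w, (V w, V' w), Y w)) = Ent J (\<lambda>w. (X w, V' w, V w, Y w))"
    by (rule Ent_inj[where h = "\<lambda>(x, b, a, c). (x, (a, b), c)"]) (auto simp: inj_def)
  ultimately show ?thesis by (simp add: cmi_def)
qed

text \<open>Puts entropies of different functions on the common index set \<open>set_pmf J\<close>,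
  where they combine term by term.\<close>

lemma Ent_eq_sum:
  assumes "finite (set_pmf J)"
  shows "Ent J f = - (\<Sum>z\<in>set_pmf J. pmf J z * log 2 (pmf (map_pmf f J) (f z)))"
proof -
  let ?g = "\<lambda>a. log 2 (pmf (map_pmf f J) a)"
  have "(\<Sum>a\<in>set_pmf (map_pmf f J). pmf (map_pmf f J) a * ?g a) = measure_pmf.expectation (map_pmf f J) ?g"
    using assms by (subst integral_measure_pmf_real[of "set_pmf (map_pmf f J)"]) (auto simp: mult.commute)
  also have "\<dots> = measure_pmf.expectation J (\<lambda>z. ?g (f z))" by simp
  also have "\<dots> = (\<Sum>z\<in>set_pmf J. pmf J z * ?g (f z))"
    using assms by (subst integral_measure_pmf_real[of "set_pmf J"]) (auto simp: mult.commute)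
  finally show ?thesis by (simp add: Ent_def entropy_pmf_def)
qed

lemma pmf_map_pos: "z \<in> set_pmf J \<Longrightarrow> 0 < pmf (map_pmf f J) (f z)"
  by (intro pmf_positive) simp

text \<open>The logarithm is the conditional information density of \<open>A\<close> and
  \<open>B\<close> given \<open>C\<close>. In this form the mutual information is a mean, as the
  weak law requires.\<close>

lemma cmi_eq_expectation:
  assumes fin: "finite (set_pmf J)"
  shows "cmi J A B C = (\<Sum>z\<in>set_pmf J. pmf J z *
    log 2 (pmf (map_pmf (\<lambda>z. (A z, B z, C z)) J) (A z, B z, C z) * pmf (map_pmf C J) (C z) /
      (pmf (map_pmf (\<lambda>z. (A z, C z)) J) (A z, C z) * pmf (map_pmf (\<lambda>z. (B z, C z)) J) (B z, C z))))"
proof -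
  have log_eq: "log 2 (pmf (map_pmf (\<lambda>z. (A z, B z, C z)) J) (A z, B z, C z) * pmf (map_pmf C J) (C z) /
      (pmf (map_pmf (\<lambda>z. (A z, C z)) J) (A z, C z) * pmf (map_pmf (\<lambda>z. (B z, C z)) J) (B z, C z))) =
    log 2 (pmf (map_pmf (\<lambda>z. (A z, B z, C z)) J) (A z, B z, C z)) + log 2 (pmf (map_pmf C J) (C z))
     - log 2 (pmf (map_pmf (\<lambda>z. (A z, C z)) J) (A z, C z)) - log 2 (pmf (map_pmf (\<lambda>z. (B z, C z)) J) (B z, C z))"
    if z: "z \<in> set_pmf J" for z
    using pmf_map_pos[OF z, of "\<lambda>z. (A z, B z, C z)"] pmf_map_pos[OF z, of C] pmf_map_pos[OF z, of "\<lambda>z. (A z, C z)"]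
      pmf_map_pos[OF z, of "\<lambda>z. (B z, C z)"]
    by (simp add: log_mult log_divide)
  show ?thesis
    unfolding cmi_def Ent_eq_sum[OF fin]
    by (subst sum.cong[OF refl, OF arg_cong[OF log_eq]])
      (simp_all add: sum.distrib sum_subtractf ring_distribs)
qed

text \<open>Gibbs' inequality, from \<open>ln t \<ge> 1 - 1 / t\<close>.\<close>
lemma cmi_nonneg:
  assumes fin: "finite (set_pmf J)"
  shows "0 \<le> cmi J A B C"
proof -
  let ?abc = "\<lambda>z. (A z, B z, C z)" and ?ac = "\<lambda>z. (A z, C z)" and ?bc = "\<lambda>z. (B z, C z)"
  \<comment> \<open>The law with the same marginals on \<open>(A, C)\<close> and
    \<open>(B, C)\<close> under which \<open>A\<close> and \<open>B\<close> are conditionally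
    independent given \<open>C\<close>. Enlarging \<open>S\<close> to a product of ranges lets both
    marginals be summed out, so its mass on \<open>S\<close> is at most 1.\<close>
  define r where "r = (\<lambda>(a, b, c). pmf (map_pmf ?ac J) (a, c) * pmf (map_pmf ?bc J) (b, c) / pmf (map_pmf C J) c)"
  define S where "S = set_pmf (map_pmf ?abc J)"
  have finS: "finite S" using fin by (simp add: S_def)
  have "(\<Sum>z\<in>set_pmf J. pmf J z * (r (?abc z) / pmf (map_pmf ?abc J) (?abc z))) =
    (\<Sum>s\<in>S. pmf (map_pmf ?abc J) s * (r s / pmf (map_pmf ?abc J) s))"
  proof -
    let ?g = "\<lambda>s. r s / pmf (map_pmf ?abc J) s"
    have "(\<Sum>s\<in>S. pmf (map_pmf ?abc J) s * ?g s) = measure_pmf.expectation (map_pmf ?abc J) ?g"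
      using finS by (subst integral_measure_pmf_real[of S]) (auto simp: mult.commute S_def)
    also have "\<dots> = measure_pmf.expectation J (\<lambda>z. ?g (?abc z))" by simp
    also have "\<dots> = (\<Sum>z\<in>set_pmf J. pmf J z * ?g (?abc z))"
      using fin by (subst integral_measure_pmf_real[of "set_pmf J"]) (auto simp: mult.commute)
    finally show ?thesis ..
  qed
  also have "\<dots> = sum r S"
  proof (intro sum.cong refl)
    fix s assume "s \<in> S"
    then have "pmf (map_pmf ?abc J) s \<noteq> 0" unfolding S_def by (simp add: set_pmf_iff del: set_map_pmf)
    then show "pmf (map_pmf ?abc J) s * (r s / pmf (map_pmf ?abc J) s) = r s" by simp
  qed
  also have "\<dots> \<le> sum r (A ` set_pmf J \<times> B ` set_pmf J \<times> C ` set_pmf J)"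
    using fin by (intro sum_mono2) (auto simp: S_def r_def)
  also have "\<dots> = (\<Sum>c\<in>C ` set_pmf J. \<Sum>a\<in>A ` set_pmf J. \<Sum>b\<in>B ` set_pmf J. r (a, b, c))"
    by (subst (2) sum.swap, subst sum.swap) (simp add: sum.cartesian_product')
  also have "\<dots> = (\<Sum>c\<in>C ` set_pmf J. pmf (map_pmf C J) c)"
  proof (intro sum.cong refl)
    have marg: "(\<Sum>a\<in>D ` set_pmf J. pmf (map_pmf (\<lambda>z. (D z, C z)) J) (a, c)) = pmf (map_pmf C J) c" for D :: "'a \<Rightarrow> 'e" and c
    proof -
      have "(\<Sum>a\<in>D ` set_pmf J. pmf (map_pmf (\<lambda>z. (D z, C z)) J) (a, c)) =
        (\<Sum>s\<in>(\<lambda>a. (a, c)) ` D ` set_pmf J. pmf (map_pmf (\<lambda>z. (D z, C z)) J) s)"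
        by (subst sum.reindex) (auto simp: inj_on_def)
      also have "\<dots> = measure_pmf.prob (map_pmf (\<lambda>z. (D z, C z)) J) ((\<lambda>a. (a, c)) ` D ` set_pmf J)"
        using fin by (intro measure_measure_pmf_finite[symmetric]) simp
      also have "\<dots> = measure_pmf.prob (map_pmf (\<lambda>z. (D z, C z)) J) (snd -` {c})"
        by (intro measure_prob_cong_0) (auto simp: pmf_eq_0_set_pmf)
      also have "\<dots> = pmf (map_pmf C J) c"
        by (simp add: pmf_map vimage_def)
      finally show ?thesis .
    qed
    fix c assume "c \<in> C ` set_pmf J"
    then have pos: "0 < pmf (map_pmf C J) c" by (auto intro: pmf_map_pos)
    have "(\<Sum>a\<in>A ` set_pmf J. \<Sum>b\<in>B ` set_pmf J. r (a, b, c)) =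
      (\<Sum>a\<in>A ` set_pmf J. pmf (map_pmf ?ac J) (a, c)) * (\<Sum>b\<in>B ` set_pmf J. pmf (map_pmf ?bc J) (b, c)) / pmf (map_pmf C J) c"
      by (simp add: r_def sum_product sum_divide_distrib)
    then show "(\<Sum>a\<in>A ` set_pmf J. \<Sum>b\<in>B ` set_pmf J. r (a, b, c)) = pmf (map_pmf C J) c"
      using pos by (simp add: marg)
  qed
  also have "\<dots> = 1"
    using fin by (intro sum_pmf_eq_1) auto
  finally have le1: "(\<Sum>z\<in>set_pmf J. pmf J z * (r (?abc z) / pmf (map_pmf ?abc J) (?abc z))) \<le> 1" .
  have "0 \<le> (\<Sum>z\<in>set_pmf J. pmf J z * ((1 - r (?abc z) / pmf (map_pmf ?abc J) (?abc z)) / ln 2))"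
  proof -
    have "(\<Sum>z\<in>set_pmf J. pmf J z * ((1 - r (?abc z) / pmf (map_pmf ?abc J) (?abc z)) / ln 2)) =
      ((\<Sum>z\<in>set_pmf J. pmf J z) - (\<Sum>z\<in>set_pmf J. pmf J z * (r (?abc z) / pmf (map_pmf ?abc J) (?abc z)))) / ln 2"
      by (simp add: sum_subtractf[symmetric] sum_divide_distrib algebra_simps)
    also have "\<dots> \<ge> 0" using le1 fin by (simp add: sum_pmf_eq_1)
    finally show ?thesis .
  qed
  also have "\<dots> \<le> cmi J A B C"
    unfolding cmi_eq_expectation[OF fin]
  proof (intro sum_mono mult_left_mono)
    fix z assume z: "z \<in> set_pmf J"
    define t where "t = pmf (map_pmf ?abc J) (?abc z) * pmf (map_pmf C J) (C z) /
      (pmf (map_pmf ?ac J) (?ac z) * pmf (map_pmf ?bc J) (?bc z))"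
    have t: "0 < t" "r (?abc z) / pmf (map_pmf ?abc J) (?abc z) = 1 / t"
      using pmf_map_pos[OF z, of ?abc] pmf_map_pos[OF z, of C] pmf_map_pos[OF z, of ?ac] pmf_map_pos[OF z, of ?bc]
      by (auto simp: t_def r_def field_simps)
    have "ln (1 / t) \<le> 1 / t - 1" using t by (intro ln_le_minus_one) simp
    then have "1 - 1 / t \<le> ln t" using t by (simp add: ln_div)
    then have "(1 - 1 / t) / ln 2 \<le> log 2 t" by (simp add: log_def divide_right_mono)
    then show "(1 - r (?abc z) / pmf (map_pmf ?abc J) (?abc z)) / ln 2 \<le> log 2 (pmf (map_pmf ?abc J) (?abc z) * pmf (map_pmf C J) (C z) /
      (pmf (map_pmf ?ac J) (?ac z) * pmf (map_pmf ?bc J) (?bc z)))"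
      using t(2) by (simp only: t_def)
  qed simp
  finally show ?thesis .
qed

section \<open>Block codes\<close>

lemma sum_pmf_le_pmf_map:
  assumes "finite B" "inj_on i B" "\<And>b. b \<in> B \<Longrightarrow> g (i b) = c"
  shows "(\<Sum>b\<in>B. pmf p (i b)) \<le> pmf (map_pmf g p) c"
proof -
  have "(\<Sum>b\<in>B. pmf p (i b)) = measure_pmf.prob p (i ` B)"
    using assms by (simp add: measure_measure_pmf_finite sum.reindex)
  also have "\<dots> \<le> measure_pmf.prob p (g -` {c})"
    using assms by (intro measure_pmf.finite_measure_mono) auto
  finally show ?thesis by (simp add: pmf_map)
qed

lemma sum_ratio_le_1:
  fixes f :: "'b \<Rightarrow> real"
  assumes "(\<Sum>b\<in>B. f b) \<le> c" "0 \<le> c"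
  shows "(\<Sum>b\<in>B. f b / c) \<le> 1"
  using assms by (cases "c = 0") (simp_all add: sum_divide_distrib[symmetric])

text \<open>Change of measure: the log-likelihood ratio of two product weights is a sum over
  letters, so a bound on that sum becomes a bound between the products.\<close>

lemma iid_weight_eq_powr:
  assumes "\<And>z. z \<in> set zs \<Longrightarrow> 0 < u z \<and> 0 < v z"
  shows "iid_weight u zs = 2 powr sum_list (map (\<lambda>z. log 2 (u z / v z)) zs) * iid_weight v zs"
  using assms
proof (induction zs)
  case (Cons z zs)
  from Cons.prems[of z] have "u z = 2 powr log 2 (u z / v z) * v z" by simp
  moreover have "iid_weight u zs = 2 powr sum_list (map (\<lambda>z. log 2 (u z / v z)) zs) * iid_weight v zs"
    using Cons by simp
  ultimately have "iid_weight u (z # zs) = (2 powr log 2 (u z / v z) * v z) *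
    (2 powr sum_list (map (\<lambda>z. log 2 (u z / v z)) zs) * iid_weight v zs)"
    by (metis iid_weight_simps(2))
  then show ?case by (simp only: iid_weight_simps list.map sum_list.Cons powr_add mult_ac)
qed simp

section \<open>Information densities and good words for a single receiver\<close>

text \<open>The type \<open>'r\<close> holds the side information of both receivers and
  \<open>y\<close> extracts what the receiver at hand observes; \<open>q\<close> is the conditional
  law of \<open>V\<^sub>0\<close> and \<open>V\<^sub>i\<close> given the source letter. Both
  receivers are instances over the same \<open>P\<close>.\<close>

locale receiver =
  fixes P :: "('x::finite \<times> 'r::finite) pmf" and y :: "'x \<times> 'r \<Rightarrow> 'y"
    and q :: "'x \<Rightarrow> (nat \<times> 'v::finite) pmf" and A0 :: "nat set"
  assumes fin_A0: "finite A0" and supp_q: "\<And>s. fst ` set_pmf (q s) \<subseteq> A0"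
begin

definition J :: "(('x \<times> 'r) \<times> nat \<times> 'v) pmf" where
  "J = bind_pmf P (\<lambda>w. map_pmf (Pair w) (q (fst w)))"

abbreviation "cX \<equiv> \<lambda>z :: ('x \<times> 'r) \<times> nat \<times> 'v. fst (fst z)"
abbreviation "cY \<equiv> \<lambda>z :: ('x \<times> 'r) \<times> nat \<times> 'v. y (fst z)"
abbreviation "cA \<equiv> \<lambda>z :: ('x \<times> 'r) \<times> nat \<times> 'v. fst (snd z)"
abbreviation "cB \<equiv> \<lambda>z :: ('x \<times> 'r) \<times> nat \<times> 'v. snd (snd z)"

text \<open>The sender's kernels are \<open>ker0 = P(V\<^sub>0 | X)\<close> and \<open>ker1 = P(V\<^sub>i | X, V\<^sub>0)\<close>; the receiver's posteriors are
  \<open>post0 = P(V\<^sub>0 | Y\<^sub>i)\<close> and \<open>post1 = P(V\<^sub>i | V\<^sub>0, Y\<^sub>i)\<close>. Off the support the quotients are 0, so these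
  are only sub-probability kernels.\<close>
definition ker0 :: "'x \<Rightarrow> nat \<Rightarrow> real" where
  "ker0 s a = pmf (map_pmf fst (q s)) a"
definition ker1 :: "'x \<Rightarrow> nat \<Rightarrow> 'v \<Rightarrow> real" where
  "ker1 s a b = pmf (q s) (a, b) / ker0 s a"
definition post0 :: "'y \<Rightarrow> nat \<Rightarrow> real" where
  "post0 t a = pmf (map_pmf (\<lambda>z. (cA z, cY z)) J) (a, t) / pmf (map_pmf cY J) t"
definition post1 :: "'y \<Rightarrow> nat \<Rightarrow> 'v \<Rightarrow> real" where
  "post1 t a b = pmf (map_pmf (\<lambda>z. (cB z, cA z, cY z)) J) (b, a, t) / pmf (map_pmf (\<lambda>z. (cA z, cY z)) J) (a, t)"

lemma set_J: "set_pmf J \<subseteq> UNIV \<times> A0 \<times> UNIV"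
  using supp_q by (fastforce simp: J_def)

lemma finite_J: "finite (set_pmf J)"
  using fin_A0 by (intro finite_subset[OF set_J]) auto

text \<open>The auxiliary pair is drawn from \<open>q\<close>, which sees only the source letter;
  given that letter it is independent of the side information. The function \<open>\<phi>\<close> is
  used to select \<open>V\<^sub>0\<close> or the whole pair.\<close>

lemma pmf_markov:
  "pmf (map_pmf (\<lambda>z. (cX z, \<phi> (snd z), cY z)) J) (s, u, t) =
    pmf (map_pmf (\<lambda>w. (fst w, y w)) P) (s, t) * pmf (map_pmf \<phi> (q s)) u"
proof -
  have inner: "pmf (map_pmf (\<lambda>v. (fst w, \<phi> v, y w)) (q (fst w))) (s, u, t) =
    of_bool ((fst w, y w) = (s, t)) * pmf (map_pmf \<phi> (q s)) u" for w
  proof (cases "(fst w, y w) = (s, t)")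
    case True
    have "map_pmf (\<lambda>v. (fst w, \<phi> v, y w)) (q (fst w)) = map_pmf (\<lambda>u. (s, u, t)) (map_pmf \<phi> (q s))"
      using True by (simp add: pmf.map_comp comp_def)
    then show ?thesis
      using True pmf_map_inj'[of "\<lambda>u. (s, u, t)"] by (simp add: inj_def)
  next
    case False
    then have "(s, u, t) \<notin> set_pmf (map_pmf (\<lambda>v. (fst w, \<phi> v, y w)) (q (fst w)))" by auto
    then show ?thesis using False by (auto simp: pmf_eq_0_set_pmf)
  qed
  have "map_pmf (\<lambda>z. (cX z, \<phi> (snd z), cY z)) J = bind_pmf P (\<lambda>w. map_pmf (\<lambda>v. (fst w, \<phi> v, y w)) (q (fst w)))"
    by (simp add: J_def map_bind_pmf pmf.map_comp comp_def)
  then have "pmf (map_pmf (\<lambda>z. (cX z, \<phi> (snd z), cY z)) J) (s, u, t) =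
     (\<Sum>w\<in>UNIV. of_bool ((fst w, y w) = (s, t)) * pmf (map_pmf \<phi> (q s)) u * pmf P w)"
    by (simp only: pmf_bind inner) (subst integral_measure_pmf_real[of UNIV], auto)
  also have "\<dots> = pmf (map_pmf \<phi> (q s)) u * (\<Sum>w\<in>UNIV. of_bool ((fst w, y w) = (s, t)) * pmf P w)"
    unfolding sum_distrib_left by (intro sum.cong) simp_all
  also have "(\<Sum>w\<in>UNIV. of_bool ((fst w, y w) = (s, t)) * pmf P w) = (\<Sum>w\<in>(\<lambda>w. (fst w, y w)) -` {(s, t)}. pmf P w)"
    by (rule sum.mono_neutral_cong_right) auto
  also have "\<dots> = pmf (map_pmf (\<lambda>w. (fst w, y w)) P) (s, t)"
    by (simp add: pmf_map measure_measure_pmf_finite)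
  finally show ?thesis by (simp add: mult.commute)
qed

lemma pmf_XAY: "pmf (map_pmf (\<lambda>z. (cX z, cA z, cY z)) J) (s, a, t) =
    pmf (map_pmf (\<lambda>z. (cX z, cY z)) J) (s, t) * ker0 s a"
  and pmf_XBAY: "pmf (map_pmf (\<lambda>z. (cX z, cB z, cA z, cY z)) J) (s, b, a, t) =
    pmf (map_pmf (\<lambda>z. (cX z, cY z)) J) (s, t) * pmf (q s) (a, b)"
proof -
  have "map_pmf (\<lambda>z. (cX z, cY z)) J = map_pmf (\<lambda>w. (fst w, y w)) (map_pmf fst J)"
    by (simp add: pmf.map_comp comp_def)
  also have "map_pmf fst J = P"
    by (simp add: J_def map_bind_pmf pmf.map_comp comp_def bind_return_pmf')
  finally have XY: "map_pmf (\<lambda>z. (cX z, cY z)) J = map_pmf (\<lambda>w. (fst w, y w)) P" .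
  show "pmf (map_pmf (\<lambda>z. (cX z, cA z, cY z)) J) (s, a, t) =
    pmf (map_pmf (\<lambda>z. (cX z, cY z)) J) (s, t) * ker0 s a"
    using pmf_markov[of fst] by (simp add: XY ker0_def)
  let ?h = "\<lambda>(s :: 'x, (a :: nat, b :: 'v), t :: 'y). (s, b, a, t)"
  have "map_pmf (\<lambda>z. (cX z, cB z, cA z, cY z)) J = map_pmf ?h (map_pmf (\<lambda>z. (cX z, snd z, cY z)) J)"
    by (simp add: pmf.map_comp comp_def case_prod_unfold)
  moreover have "inj ?h" by (auto simp: inj_def)
  ultimately have "pmf (map_pmf (\<lambda>z. (cX z, cB z, cA z, cY z)) J) (s, b, a, t) =
    pmf (map_pmf (\<lambda>z. (cX z, snd z, cY z)) J) (s, (a, b), t)"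
    using pmf_map_inj'[of ?h _ "(s, (a, b), t)"] by simp
  then show "pmf (map_pmf (\<lambda>z. (cX z, cB z, cA z, cY z)) J) (s, b, a, t) =
    pmf (map_pmf (\<lambda>z. (cX z, cY z)) J) (s, t) * pmf (q s) (a, b)"
    using pmf_markov[of "\<lambda>v. v"] by (simp add: XY)
qed

lemma nonneg: "0 \<le> ker0 s a" "0 \<le> ker1 s a b" "0 \<le> post0 t a" "0 \<le> post1 t a b"
  by (simp_all add: ker0_def ker1_def post0_def post1_def)

lemma sum_le_1:
  "(\<Sum>a\<in>A0. ker0 s a) \<le> 1" "(\<Sum>b\<in>UNIV. ker1 s a b) \<le> 1"
  "(\<Sum>a\<in>A0. post0 t a) \<le> 1" "(\<Sum>b\<in>UNIV. post1 t a b) \<le> 1"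
proof -
  show "(\<Sum>a\<in>A0. ker0 s a) \<le> 1"
    unfolding ker0_def by (subst measure_measure_pmf_finite[symmetric]) (simp_all add: fin_A0)
  show "(\<Sum>b\<in>UNIV. ker1 s a b) \<le> 1"
    unfolding ker1_def
    by (intro sum_ratio_le_1 nonneg) (auto simp: ker0_def inj_on_def intro!: sum_pmf_le_pmf_map)
  have "(\<Sum>a\<in>A0. pmf (map_pmf (\<lambda>z. (cA z, cY z)) J) (a, t)) \<le> pmf (map_pmf snd (map_pmf (\<lambda>z. (cA z, cY z)) J)) t"
    by (intro sum_pmf_le_pmf_map) (auto simp: fin_A0 inj_on_def)
  then show "(\<Sum>a\<in>A0. post0 t a) \<le> 1"
    unfolding post0_def by (intro sum_ratio_le_1) (simp_all add: pmf.map_comp comp_def)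
  have "(\<Sum>b\<in>UNIV. pmf (map_pmf (\<lambda>z. (cB z, cA z, cY z)) J) (b, a, t)) \<le> pmf (map_pmf snd (map_pmf (\<lambda>z. (cB z, cA z, cY z)) J)) (a, t)"
    by (intro sum_pmf_le_pmf_map) (auto simp: inj_on_def)
  then show "(\<Sum>b\<in>UNIV. post1 t a b) \<le> 1"
    unfolding post1_def by (intro sum_ratio_le_1) (simp_all add: pmf.map_comp comp_def)
qed

lemma pmf_J: "pmf J (w, a, b) = pmf P w * pmf (q (fst w)) (a, b)"
proof -
  have "pmf (map_pmf (Pair w') (q (fst w'))) (w, a, b) = of_bool (w' = w) * pmf (q (fst w)) (a, b)" for w'
  proof (cases "w' = w")
    case True
    then show ?thesis using pmf_map_inj'[of "Pair w"] by (simp add: inj_def)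
  next
    case False
    then have "(w, a, b) \<notin> set_pmf (map_pmf (Pair w') (q (fst w')))" by auto
    then show ?thesis using False by (auto simp: pmf_eq_0_set_pmf)
  qed
  then have "pmf J (w, a, b) = (\<Sum>w'\<in>UNIV. of_bool (w' = w) * pmf (q (fst w)) (a, b) * pmf P w')"
    unfolding J_def by (simp only: pmf_bind) (subst integral_measure_pmf_real[of UNIV], auto)
  also have "\<dots> = pmf P w * pmf (q (fst w)) (a, b)"
    by (subst sum.remove[of _ w]) (auto intro!: sum.neutral)
  finally show ?thesis .
qed

lemma pmf_q_le_ker0: "pmf (q s) (a, b) \<le> ker0 s a"
  using sum_pmf_le_pmf_map[of "{b}" "Pair a" fst a "q s"] by (simp add: ker0_def)

text \<open>Where \<open>ker0\<close> vanishes, so does the joint mass of the pair, and the value 0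
  of the quotient in \<open>ker1\<close> does no harm.\<close>

lemma pmf_J_factor: "pmf J (w, a, b) = pmf P w * ker0 (fst w) a * ker1 (fst w) a b"
  using pmf_q_le_ker0[of "fst w" a b] by (cases "ker0 (fst w) a = 0") (auto simp: pmf_J ker1_def order_antisym)

lemma support_pos:
  assumes "z \<in> set_pmf J"
  shows "0 < ker0 (cX z) (cA z)" "0 < ker1 (cX z) (cA z) (cB z)" "0 < post0 (cY z) (cA z)" "0 < post1 (cY z) (cA z) (cB z)"
proof -
  have "0 < pmf P (fst z) * ker0 (cX z) (cA z) * ker1 (cX z) (cA z) (cB z)"
    unfolding pmf_J_factor[symmetric] using assms by (simp add: pmf_positive)
  then show "0 < ker0 (cX z) (cA z)" "0 < ker1 (cX z) (cA z) (cB z)"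
    using nonneg(1)[of "cX z" "cA z"] nonneg(2)[of "cX z" "cA z" "cB z"] by (auto simp: order_less_le)
  show "0 < post0 (cY z) (cA z)" "0 < post1 (cY z) (cA z) (cB z)"
    using pmf_map_pos[OF assms, of cY] pmf_map_pos[OF assms, of "\<lambda>z. (cA z, cY z)"]
      pmf_map_pos[OF assms, of "\<lambda>z. (cB z, cA z, cY z)"] by (simp_all add: post0_def post1_def)
qed

text \<open>By the Markov factorisation the joint mass of source and side information cancels from
  the density. What is left is the ratio of the sender's kernel to the receiver's posterior, which
  is the ratio that governs the race.\<close>

lemma mean_density_0:
  "(\<Sum>z\<in>set_pmf J. pmf J z * log 2 (ker0 (cX z) (cA z) / post0 (cY z) (cA z))) = cmi J cX cA cY"
  unfolding cmi_eq_expectation[OF finite_J]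
proof (intro sum.cong refl)
  fix z assume z: "z \<in> set_pmf J"
  show "pmf J z * log 2 (ker0 (cX z) (cA z) / post0 (cY z) (cA z)) = pmf J z *
    log 2 (pmf (map_pmf (\<lambda>z. (cX z, cA z, cY z)) J) (cX z, cA z, cY z) * pmf (map_pmf cY J) (cY z) /
      (pmf (map_pmf (\<lambda>z. (cX z, cY z)) J) (cX z, cY z) * pmf (map_pmf (\<lambda>z. (cA z, cY z)) J) (cA z, cY z)))"
    using pmf_map_pos[OF z, of "\<lambda>z. (cX z, cY z)"] unfolding pmf_XAY post0_def by simp
qed

text \<open>The same cancellation one layer up, where dividing by \<open>ker0\<close> turns the law
  of the pair into \<open>ker1\<close>.\<close>

lemma mean_density_1:
  "(\<Sum>z\<in>set_pmf J. pmf J z * log 2 (ker1 (cX z) (cA z) (cB z) / post1 (cY z) (cA z) (cB z))) =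
    cmi J cX cB (\<lambda>z. (cA z, cY z))"
  unfolding cmi_eq_expectation[OF finite_J]
proof (intro sum.cong refl)
  fix z assume z: "z \<in> set_pmf J"
  show "pmf J z * log 2 (ker1 (cX z) (cA z) (cB z) / post1 (cY z) (cA z) (cB z)) = pmf J z *
    log 2 (pmf (map_pmf (\<lambda>z. (cX z, cB z, cA z, cY z)) J) (cX z, cB z, cA z, cY z) *
        pmf (map_pmf (\<lambda>z. (cA z, cY z)) J) (cA z, cY z) /
      (pmf (map_pmf (\<lambda>z. (cX z, cA z, cY z)) J) (cX z, cA z, cY z) *
       pmf (map_pmf (\<lambda>z. (cB z, cA z, cY z)) J) (cB z, cA z, cY z)))"
    using pmf_map_pos[OF z, of "\<lambda>z. (cX z, cY z)"] support_pos[OF z]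
    unfolding pmf_XAY pmf_XBAY ker1_def post1_def by simp
qed

lemma mean_indicator:
  "(\<Sum>z\<in>set_pmf J. pmf J z * of_bool (f z = c)) = pmf (map_pmf f J) c"
proof -
  have "(\<Sum>z\<in>set_pmf J. pmf J z * of_bool (f z = c)) = (\<Sum>z\<in>f -` {c} \<inter> set_pmf J. pmf J z)"
    using finite_J by (intro sum.mono_neutral_cong_right) auto
  also have "\<dots> = pmf (map_pmf f J) c"
    using finite_J by (simp add: pmf_map measure_measure_pmf_finite[symmetric] measure_Int_set_pmf)
  finally show ?thesis .
qed

text \<open>The event on which both layers are meant to be decoded. The density bounds are kept in
  product form, ready for the one-shot code once the powers of 2 are compared with message
  counts.\<close>

definition good :: "real \<Rightarrow> real \<Rightarrow> nat \<Rightarrow> (('x \<times> 'r) \<times> nat \<times> 'v) list \<Rightarrow> bool" where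
  "good \<epsilon> \<delta> n zs \<longleftrightarrow> typical \<epsilon> (map_pmf (\<lambda>z. (cX z, cB z)) J) (map (\<lambda>z. (cX z, cB z)) zs) \<and>
    iid_weight (\<lambda>z. ker0 (cX z) (cA z)) zs \<le>
      2 powr (real n * (cmi J cX cA cY + \<delta>)) * iid_weight (\<lambda>z. post0 (cY z) (cA z)) zs \<and>
    iid_weight (\<lambda>z. ker1 (cX z) (cA z) (cB z)) zs \<le>
      2 powr (real n * (cmi J cX cB (\<lambda>z. (cA z, cY z)) + \<delta>)) * iid_weight (\<lambda>z. post1 (cY z) (cA z) (cB z)) zs"

lemma good_words_prob:
  assumes "0 < \<epsilon>" "0 < \<delta>"
  shows "(\<lambda>n. \<Sum>zs | zs \<in> words n (set_pmf J) \<and> good \<epsilon> \<delta> n zs. iid_weight (pmf J) zs) \<longlonglongrightarrow> 1"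
proof -
  let ?L = "map_pmf (\<lambda>z. (cX z, cB z)) J"
  \<comment> \<open>\<open>Inl c\<close> counts occurrences of the letter pair \<open>c\<close>;
    \<open>Inr False\<close> and \<open>Inr True\<close> are the information densities of the first
    and second layer.\<close>
  define f :: "('x \<times> 'v) + bool \<Rightarrow> ('x \<times> 'r) \<times> nat \<times> 'v \<Rightarrow> real" where
    "f = case_sum (\<lambda>c z. of_bool ((cX z, cB z) = c))
      (\<lambda>b z. if b then log 2 (ker1 (cX z) (cA z) (cB z) / post1 (cY z) (cA z) (cB z)) else log 2 (ker0 (cX z) (cA z) / post0 (cY z) (cA z)))"
  define \<Delta> where "\<Delta> = case_sum (\<lambda>c. \<epsilon> * pmf ?L c) (\<lambda>_ :: bool. \<delta>)"
  \<comment> \<open>Only pairs in the support are included, since the tolerance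
    \<open>\<epsilon> * pmf ?L c\<close> must be positive for the weak law.\<close>
  define C :: "(('x \<times> 'v) + bool) set" where "C = set_pmf ?L <+> UNIV"
  have finC: "finite C" using finite_J by (simp add: C_def)
  have \<Delta>: "0 < \<Delta> c" if "c \<in> C" for c 
    using that assms by (auto simp: C_def \<Delta>_def simp del: set_map_pmf intro!: mult_pos_pos pmf_positive)
  let ?conc = "\<lambda>n zs. \<forall>c\<in>C. \<bar>sum_list (map (f c) zs) - real n * (\<Sum>z\<in>set_pmf J. pmf J z * f c z)\<bar> \<le> real n * \<Delta> c"
  have one: "(\<Sum>z\<in>set_pmf J. pmf J z) = 1" using finite_J by (simp add: sum_pmf_eq_1)
  have lim: "(\<lambda>n. \<Sum>zs | zs \<in> words n (set_pmf J) \<and> ?conc n zs. iid_weight (pmf J) zs) \<longlonglongrightarrow> 1"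
    using finite_J finC one \<Delta> by (intro all_empirical_means_converge) auto
  have imp: "good \<epsilon> \<delta> n zs" if zs: "zs \<in> words n (set_pmf J)" and conc: "?conc n zs" and n: "n > 0" for n zs
    unfolding good_def
  proof (intro conjI)
    have len: "length zs = n" and set: "set zs \<subseteq> set_pmf J" using zs by (auto simp: words_def)
    show "typical \<epsilon> ?L (map (\<lambda>z. (cX z, cB z)) zs)"
      unfolding typical_def
    proof
      fix c
      have emp: "emp (map (\<lambda>z. (cX z, cB z)) zs) c = sum_list (map (f (Inl c)) zs) / real n"
        using len by (simp add: emp_eq_sum_list f_def comp_def)
      show "\<bar>emp (map (\<lambda>z. (cX z, cB z)) zs) c - pmf ?L c\<bar> \<le> \<epsilon> * pmf ?L c"
      proof (cases "c \<in> set_pmf ?L")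
        case True
        then have "Inl c \<in> C" by (auto simp: C_def)
        with conc have "\<bar>sum_list (map (f (Inl c)) zs) - real n * (\<Sum>z\<in>set_pmf J. pmf J z * f (Inl c) z)\<bar> \<le> real n * \<Delta> (Inl c)"
          by blast
        moreover have "(\<Sum>z\<in>set_pmf J. pmf J z * f (Inl c) z) = pmf ?L c"
          using mean_indicator[of "\<lambda>z. (cX z, cB z)" c] by (simp add: f_def)
        ultimately have "\<bar>sum_list (map (f (Inl c)) zs) - real n * pmf ?L c\<bar> \<le> real n * (\<epsilon> * pmf ?L c)"
          by (simp add: \<Delta>_def)
        moreover have "sum_list (map (f (Inl c)) zs) / real n - pmf ?L c = (sum_list (map (f (Inl c)) zs) - real n * pmf ?L c) / real n"
          using n by (simp add: field_simps)
        ultimately show ?thesis using n unfolding emp by (simp add: abs_divide field_simps)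
      next
        \<comment> \<open>Typicality allows a pair of mass 0 no deviation at all; such a pair never
          occurs in a word over the support of \<open>J\<close>.\<close>
        case False
        then have "f (Inl c) z = 0" if "z \<in> set zs" for z using that set by (auto simp: f_def)
        then have "sum_list (map (f (Inl c)) zs) = 0" by (simp add: sum_list_0 cong: map_cong)
        moreover have "pmf ?L c = 0" using False by (simp add: pmf_eq_0_set_pmf del: set_map_pmf)
        ultimately show ?thesis unfolding emp by simp
      qed
    qed
    have C: "Inr b \<in> C" for b by (auto simp: C_def)
    have "sum_list (map (f (Inr False)) zs) \<le> real n * (cmi J cX cA cY + \<delta>)"
      using conc[rule_format, OF C[of False]] mean_density_0 by (simp add: f_def \<Delta>_def ring_distribs abs_le_iff)
    then show "iid_weight (\<lambda>z. ker0 (cX z) (cA z)) zs \<le>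
      2 powr (real n * (cmi J cX cA cY + \<delta>)) * iid_weight (\<lambda>z. post0 (cY z) (cA z)) zs"
      using set support_pos by (subst iid_weight_eq_powr[where v = "\<lambda>z. post0 (cY z) (cA z)"])
        (auto simp: f_def intro!: mult_right_mono iid_weight_nonneg nonneg)
    have "sum_list (map (f (Inr True)) zs) \<le> real n * (cmi J cX cB (\<lambda>z. (cA z, cY z)) + \<delta>)"
      using conc[rule_format, OF C[of True]] mean_density_1 by (simp add: f_def \<Delta>_def ring_distribs abs_le_iff)
    then show "iid_weight (\<lambda>z. ker1 (cX z) (cA z) (cB z)) zs \<le>
      2 powr (real n * (cmi J cX cB (\<lambda>z. (cA z, cY z)) + \<delta>)) * iid_weight (\<lambda>z. post1 (cY z) (cA z) (cB z)) zs"
      using set support_pos by (subst iid_weight_eq_powr[where v = "\<lambda>z. post1 (cY z) (cA z) (cB z)"])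
        (auto simp: f_def intro!: mult_right_mono iid_weight_nonneg nonneg)
  qed
  show ?thesis
  proof (rule tendsto_sandwich[OF _ always_eventually lim tendsto_const])
    show "\<forall>\<^sub>F n in sequentially. (\<Sum>zs | zs \<in> words n (set_pmf J) \<and> ?conc n zs. iid_weight (pmf J) zs) \<le>
      (\<Sum>zs | zs \<in> words n (set_pmf J) \<and> good \<epsilon> \<delta> n zs. iid_weight (pmf J) zs)"
      using eventually_gt_at_top[of 0]
    proof eventually_elim
      case (elim n)
      then show ?case
        using imp finite_J by (intro sum_mono2) (auto intro!: iid_weight_nonneg)
    qed
    show "\<forall>n. (\<Sum>zs | zs \<in> words n (set_pmf J) \<and> good \<epsilon> \<delta> n zs. iid_weight (pmf J) zs) \<le> 1"
    proof
      fix n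
      have "(\<Sum>zs | zs \<in> words n (set_pmf J) \<and> good \<epsilon> \<delta> n zs. iid_weight (pmf J) zs) \<le> (\<Sum>zs\<in>words n (set_pmf J). iid_weight (pmf J) zs)"
        using finite_J by (intro sum_mono2) (auto intro!: iid_weight_nonneg)
      then show "(\<Sum>zs | zs \<in> words n (set_pmf J) \<and> good \<epsilon> \<delta> n zs. iid_weight (pmf J) zs) \<le> 1"
        using one by (simp add: sum_iid_weight)
    qed
  qed
qed

end

section \<open>Product kernels on words\<close>

lemma iid_weight_mult: "iid_weight (\<lambda>z. f z * g z) zs = iid_weight f zs * iid_weight g zs"
  by (induction zs) (simp_all add: mult_ac)

lemma iid_weight_map: "iid_weight g (map h zs) = iid_weight (\<lambda>z. g (h z)) zs"
  by (induction zs) simp_all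

lemma zip_map_same: "zip (map f zs) (map g zs) = map (\<lambda>z. (f z, g z)) zs"
  by (induction zs) simp_all

text \<open>The memoryless extension of a single-letter kernel.\<close>

definition seq_kernel :: "('a \<Rightarrow> 'b \<Rightarrow> real) \<Rightarrow> 'a list \<Rightarrow> 'b list \<Rightarrow> real" where
  "seq_kernel f xs vs = prod_list (map2 f xs vs)"

definition seq_kernel2 :: "('a \<Rightarrow> 'b \<Rightarrow> 'c \<Rightarrow> real) \<Rightarrow> 'a list \<Rightarrow> 'b list \<Rightarrow> 'c list \<Rightarrow> real" where
  "seq_kernel2 f xs us = seq_kernel (case_prod f) (zip xs us)"

lemma seq_kernel_map: "seq_kernel f (map g zs) (map h zs) = iid_weight (\<lambda>z. f (g z) (h z)) zs"
  by (simp add: seq_kernel_def iid_weight_def zip_map_same comp_def)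

lemma seq_kernel2_map:
  "seq_kernel2 f (map g zs) (map h zs) (map l zs) = iid_weight (\<lambda>z. f (g z) (h z) (l z)) zs"
  by (simp add: seq_kernel2_def zip_map_same seq_kernel_map)

lemma seq_kernel_nonneg: "(\<And>x v. 0 \<le> f x v) \<Longrightarrow> 0 \<le> seq_kernel f xs vs"
  by (auto simp: seq_kernel_def intro!: prod_list_nonneg)

text \<open>The sum over words factors into one letter sum per position, each at most 1.\<close>

lemma sum_seq_kernel_le_1:
  assumes "\<And>x v. 0 \<le> f x v" "\<And>x. (\<Sum>a\<in>A. f x a) \<le> 1" "length xs = n"
  shows "sum (seq_kernel f xs) (words n A) \<le> 1"
proof -
  have "sum (seq_kernel f xs) (words n A) = prod_list (map (\<lambda>x. \<Sum>a\<in>A. f x a) xs)"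
    unfolding seq_kernel_def assms(3)[symmetric] by (rule sum_words_prod_list_map2)
  also have "\<dots> \<le> 1" using assms by (intro prod_list_le_one) (auto intro!: sum_nonneg)
  finally show ?thesis .
qed

context receiver
begin

text \<open>Good words are unzipped because the one-shot code keeps source outcome, first-layer
  letter and second-layer letter apart.\<close>

definition good_triples :: "real \<Rightarrow> real \<Rightarrow> nat \<Rightarrow> (('x \<times> 'r) list \<times> nat list \<times> 'v list) set" where
  "good_triples \<epsilon> \<delta> n = (\<lambda>zs. (map fst zs, map cA zs, map cB zs)) ` {zs. zs \<in> words n (set_pmf J) \<and> good \<epsilon> \<delta> n zs}"

lemma good_triples_subset: "good_triples \<epsilon> \<delta> n \<subseteq> words n UNIV \<times> words n A0 \<times> words n UNIV"
  using set_J by (fastforce simp: good_triples_def words_def)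

text \<open>Unzipping is injective, with zipping as its inverse, and the weight of \<open>J\<close>
  factors letterwise into source and kernels. Thus the success mass in the one-shot bound is the
  probability of a good word.\<close>

lemma sum_good_triples:
  "(\<Sum>(ws, as, bs)\<in>good_triples \<epsilon> \<delta> n. iid_weight (pmf P) ws * seq_kernel ker0 (map fst ws) as * seq_kernel2 ker1 (map fst ws) as bs) =
    (\<Sum>zs | zs \<in> words n (set_pmf J) \<and> good \<epsilon> \<delta> n zs. iid_weight (pmf J) zs)"
proof -
  have "inj_on (\<lambda>zs :: (('x \<times> 'r) \<times> nat \<times> 'v) list. (map fst zs, map cA zs, map cB zs)) X" for X
  proof (rule inj_on_inverseI[where g = "\<lambda>(ws, as, bs). zip ws (zip as bs)"])
    fix zs :: "(('x \<times> 'r) \<times> nat \<times> 'v) list"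
    show "(\<lambda>(ws, as, bs). zip ws (zip as bs)) (map fst zs, map cA zs, map cB zs) = zs"
      by (simp add: zip_map_same)
  qed
  moreover have "iid_weight (pmf P) (map fst zs) * seq_kernel ker0 (map fst (map fst zs)) (map cA zs) *
      seq_kernel2 ker1 (map fst (map fst zs)) (map cA zs) (map cB zs) = iid_weight (pmf J) zs" for zs
  proof -
    have "iid_weight (pmf J) zs = iid_weight (\<lambda>z. pmf P (fst z) * ker0 (cX z) (cA z) * ker1 (cX z) (cA z) (cB z)) zs"
      by (simp add: pmf_J_factor[symmetric])
    then show ?thesis
      unfolding map_map by (simp add: seq_kernel_map seq_kernel2_map iid_weight_map iid_weight_mult)
  qed
  ultimately show ?thesis unfolding good_triples_def by (simp add: sum.reindex del: map_map)
qed

lemma good_triples_density: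
  assumes "(ws, as, bs) \<in> good_triples \<epsilon> \<delta> n"
  shows "seq_kernel ker0 (map fst ws) as \<le> 2 powr (real n * (cmi J cX cA cY + \<delta>)) * seq_kernel post0 (map y ws) as"
    "seq_kernel2 ker1 (map fst ws) as bs \<le>
      2 powr (real n * (cmi J cX cB (\<lambda>z. (cA z, cY z)) + \<delta>)) * seq_kernel2 post1 (map y ws) as bs"
proof -
  from assms obtain zs where zs: "ws = map fst zs" "as = map cA zs" "bs = map cB zs" "good \<epsilon> \<delta> n zs"
    by (auto simp: good_triples_def)
  then show "seq_kernel ker0 (map fst ws) as \<le> 2 powr (real n * (cmi J cX cA cY + \<delta>)) * seq_kernel post0 (map y ws) as"
    "seq_kernel2 ker1 (map fst ws) as bs \<le>
      2 powr (real n * (cmi J cX cB (\<lambda>z. (cA z, cY z)) + \<delta>)) * seq_kernel2 post1 (map y ws) as bs"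
    by (simp_all add: good_def seq_kernel_map seq_kernel2_map comp_def)
qed

lemma good_triples_typical:
  assumes "(ws, as, bs) \<in> good_triples \<epsilon> \<delta> n"
  shows "jtypical \<epsilon> (map_pmf (\<lambda>z. (cX z, cB z)) J) (map fst ws) bs"
  using assms by (auto simp: good_triples_def jtypical_def good_def zip_map_same)

lemma kernels_nonneg:
  "0 \<le> seq_kernel ker0 xs as" "0 \<le> seq_kernel post0 ys as"
  "0 \<le> seq_kernel2 ker1 xs as bs" "0 \<le> seq_kernel2 post1 ys as bs"
  by (auto simp: seq_kernel2_def nonneg intro!: seq_kernel_nonneg)

lemma kernels_sum_le_1:
  assumes "length ws = n"
  shows "sum (seq_kernel ker0 (map fst ws)) (words n A0) \<le> 1"
    "sum (seq_kernel post0 (map y ws)) (words n A0) \<le> 1"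
  using assms by (auto simp: nonneg sum_le_1 intro!: sum_seq_kernel_le_1)

lemma kernels2_sum_le_1:
  assumes "length ws = n" "length as = n"
  shows "sum (seq_kernel2 ker1 (map fst ws) as) (words n UNIV) \<le> 1"
    "sum (seq_kernel2 post1 (map y ws) as) (words n UNIV) \<le> 1"
  using assms unfolding seq_kernel2_def
  by (auto simp: nonneg sum_le_1 intro!: sum_seq_kernel_le_1)

end

section \<open>Error probabilities and message counts\<close>

lemma prob_iid_eq: "prob_iid P n E = (\<Sum>ws | ws \<in> words n UNIV \<and> E ws. iid_weight (pmf P) ws)"
  by (simp add: prob_iid_def words_def iid_weight_def)

lemma prob_iid_not:
  fixes P :: "'a::finite pmf"
  shows "prob_iid P n (\<lambda>ws. \<not> E ws) = 1 - prob_iid P n E"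
proof -
  have "(\<Sum>ws\<in>words n UNIV. iid_weight (pmf P) ws) = 1"
    by (intro sum_iid_weight sum_pmf_eq_1) auto
  then show ?thesis
    using sum_split_pred[of "words n UNIV" "iid_weight (pmf P)" E] by (simp add: prob_iid_eq)
qed

lemma prob_iid_nonneg: "0 \<le> prob_iid P n E"
  unfolding prob_iid_eq by (intro sum_nonneg iid_weight_nonneg) simp

lemma prob_iid_mono:
  fixes P :: "'a::finite pmf"
  assumes "\<And>ws. ws \<in> words n UNIV \<Longrightarrow> E ws \<Longrightarrow> F ws"
  shows "prob_iid P n E \<le> prob_iid P n F"
  unfolding prob_iid_eq using assms by (intro sum_mono2) (auto intro!: iid_weight_nonneg)

definition ncodes :: "nat \<Rightarrow> real \<Rightarrow> nat" where
  "ncodes n R = nat \<lfloor>2 powr (real n * R)\<rfloor>"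

text \<open>Since \<open>2 powr (real n * R)\<close> is at least 1, rounding it down loses at most a
  factor 2.\<close>

lemma ncodes_bounds:
  assumes "0 \<le> R"
  shows "0 < ncodes n R" "real (ncodes n R) \<le> 2 powr (real n * R)" "2 powr (real n * R) \<le> 2 * real (ncodes n R)"
proof -
  have ge1: "1 \<le> 2 powr (real n * R)" using assms by (intro ge_one_powr_ge_zero) auto
  then have f: "1 \<le> \<lfloor>2 powr (real n * R)\<rfloor>" by simp
  show "0 < ncodes n R" using f by (simp add: ncodes_def)
  have eq: "real (ncodes n R) = of_int \<lfloor>2 powr (real n * R)\<rfloor>" using f by (simp add: ncodes_def)
  show "real (ncodes n R) \<le> 2 powr (real n * R)" unfolding eq by simp
  have "2 powr (real n * R) < of_int \<lfloor>2 powr (real n * R)\<rfloor> + 1" by linarith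
  moreover have "(1 :: real) \<le> of_int \<lfloor>2 powr (real n * R)\<rfloor>" using f by linarith
  ultimately show "2 powr (real n * R) \<le> 2 * real (ncodes n R)" unfolding eq by linarith
qed

text \<open>This lets a link of rate \<open>R + R'\<close> carry a pair of indices of rates
  \<open>R\<close> and \<open>R'\<close>.\<close>

lemma ncodes_mult_le:
  assumes "0 \<le> R" "0 \<le> R'"
  shows "ncodes n R * ncodes n R' \<le> ncodes n (R + R')"
proof -
  have "real (ncodes n R * ncodes n R') \<le> 2 powr (real n * R) * 2 powr (real n * R')"
    using ncodes_bounds[OF assms(1)] ncodes_bounds[OF assms(2)] by (auto intro!: mult_mono)
  also have "\<dots> = 2 powr (real n * (R + R'))" by (simp add: powr_add ring_distribs)
  finally show ?thesis unfolding ncodes_def[of n "R + R'"] by (simp add: le_nat_floor)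
qed

text \<open>Of the slack \<open>2 * \<delta>\<close> in the rate, one \<delta> covers the deviation
  of the density; the other yields the exponentially small factor that serves as \<eta> in the
  one-shot code.\<close>

lemma powr_le_ncodes:
  assumes "0 \<le> R" "\<mu> + 2 * \<delta> \<le> R"
  shows "2 powr (real n * (\<mu> + \<delta>)) \<le> 4 * 2 powr (- (real n * \<delta>)) * real (ncodes n R)"
proof -
  have "real n * (\<mu> + 2 * \<delta>) \<le> real n * R" using assms by (intro mult_left_mono) auto
  then have "2 powr (real n * (\<mu> + \<delta>)) \<le> 2 powr (- (real n * \<delta>) + real n * R)"
    by (intro powr_mono) (auto simp: algebra_simps)
  also have "\<dots> = 2 powr (- (real n * \<delta>)) * 2 powr (real n * R)" by (simp only: powr_add)
  \<comment> \<open>Rounding costs only one factor 2 here; the second makes the constant agree with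
    that for two links.\<close>
  also have "\<dots> \<le> 2 powr (- (real n * \<delta>)) * (2 * (2 * real (ncodes n R)))"
    using ncodes_bounds[OF assms(1), of n] by (intro mult_left_mono) auto
  finally show ?thesis by (simp add: mult_ac)
qed

lemma powr_le_ncodes_mult:
  assumes "0 \<le> R" "0 \<le> R'" "\<mu> + 2 * \<delta> \<le> R + R'"
  shows "2 powr (real n * (\<mu> + \<delta>)) \<le> 4 * 2 powr (- (real n * \<delta>)) * (real (ncodes n R) * real (ncodes n R'))"
proof -
  have "real n * (\<mu> + 2 * \<delta>) \<le> real n * (R + R')" using assms by (intro mult_left_mono) auto
  then have "2 powr (real n * (\<mu> + \<delta>)) \<le> 2 powr (- (real n * \<delta>) + (real n * R + real n * R'))"
    by (intro powr_mono) (auto simp: algebra_simps)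
  also have "\<dots> = 2 powr (- (real n * \<delta>)) * (2 powr (real n * R) * 2 powr (real n * R'))" by (simp only: powr_add)
  also have "\<dots> \<le> 2 powr (- (real n * \<delta>)) * ((2 * real (ncodes n R)) * (2 * real (ncodes n R')))"
    using ncodes_bounds[OF assms(1), of n] ncodes_bounds[OF assms(2), of n] by (intro mult_left_mono mult_mono) auto
  finally show ?thesis by (simp add: mult_ac)
qed

section \<open>Achievability of the inner region\<close>

text \<open>The one-shot code on words of length \<open>n\<close>. The private rates are split in
  advance: \<open>S1\<close> and \<open>S2\<close> carry bins of \<open>V\<^sub>0\<close>, while
  \<open>R1\<close> and \<open>R2\<close> carry the second layers.\<close>

lemma eps_achievable_split_rates:
  fixes P :: "('x::finite \<times> 'y1::finite \<times> 'y2::finite) pmf"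
    and q1 :: "'x \<Rightarrow> (nat \<times> 'v1::finite) pmf" and q2 :: "'x \<Rightarrow> (nat \<times> 'v2::finite) pmf"
  assumes r1: "receiver q1 A0" and r2: "receiver q2 A0"
    and same: "\<And>s. map_pmf fst (q1 s) = map_pmf fst (q2 s)"
  defines "J1 \<equiv> receiver.J P q1" and "J2 \<equiv> receiver.J P q2"
  assumes "0 < \<epsilon>" "0 < \<delta>" and rates: "0 \<le> R0" "0 \<le> S1" "0 \<le> S2" "0 \<le> R1" "0 \<le> R2"
    and bounds: "cmi J1 (\<lambda>z. fst (fst z)) (\<lambda>z. fst (snd z)) (\<lambda>z. fst (snd (fst z))) + 2 * \<delta> \<le> R0 + S1"
      "cmi J1 (\<lambda>z. fst (fst z)) (\<lambda>z. snd (snd z)) (\<lambda>z. (fst (snd z), fst (snd (fst z)))) + 2 * \<delta> \<le> R1"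
      "cmi J2 (\<lambda>z. fst (fst z)) (\<lambda>z. fst (snd z)) (\<lambda>z. snd (snd (fst z))) + 2 * \<delta> \<le> R0 + S2"
      "cmi J2 (\<lambda>z. fst (fst z)) (\<lambda>z. snd (snd z)) (\<lambda>z. (fst (snd z), snd (snd (fst z)))) + 2 * \<delta> \<le> R2"
  shows "eps_achievable P (\<lambda>s. map_pmf snd (q1 s)) (\<lambda>s. map_pmf snd (q2 s)) \<epsilon> (R0, S1 + R1, S2 + R2)"
proof -
  interpret r1: receiver P "\<lambda>w. fst (snd w)" q1 A0 by (rule r1)
  interpret r2: receiver P "\<lambda>w. snd (snd w)" q2 A0 by (rule r2)
  \<comment> \<open>Both receivers refer to the same kernel for \<open>V\<^sub>0\<close>, so one
    race of the sender serves them both.\<close>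
  have ker0: "r2.ker0 = r1.ker0" by (simp add: fun_eq_iff r1.ker0_def r2.ker0_def same)
  have law: "law_XV P (\<lambda>s. map_pmf snd (q1 s)) = map_pmf (\<lambda>z. (fst (fst z), snd (snd z))) r1.J"
    "law_XV P (\<lambda>s. map_pmf snd (q2 s)) = map_pmf (\<lambda>z. (fst (fst z), snd (snd z))) r2.J"
    by (simp_all add: law_XV_def r1.J_def r2.J_def map_bind_pmf bind_map_pmf pmf.map_comp comp_def)
  define \<eta> where "\<eta> n = 4 * 2 powr (- (real n * \<delta>))" for n
  have \<eta>0: "0 \<le> \<eta> n" for n by (simp add: \<eta>_def)
  define p1 p2 where
    "p1 n = (\<Sum>zs | zs \<in> words n (set_pmf r1.J) \<and> r1.good \<epsilon> \<delta> n zs. iid_weight (pmf r1.J) zs)" and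
    "p2 n = (\<Sum>zs | zs \<in> words n (set_pmf r2.J) \<and> r2.good \<epsilon> \<delta> n zs. iid_weight (pmf r2.J) zs)" for n
  have ex: "\<exists>enc dec1 dec2. (\<forall>s. enc s \<in> {1..ncodes n R0} \<times> {1..ncodes n S1 * ncodes n R1} \<times> {1..ncodes n S2 * ncodes n R2}) \<and>
    (p1 n + p2 n) / (1 + \<eta> n)\<^sup>2
    \<le> (\<Sum>w | w \<in> words n UNIV \<and> (\<exists>a. (w, a, dec1 (fst (enc (map fst w))) (fst (snd (enc (map fst w)))) (map (\<lambda>w. fst (snd w)) w)) \<in> r1.good_triples \<epsilon> \<delta> n). iid_weight (pmf P) w) +
      (\<Sum>w | w \<in> words n UNIV \<and> (\<exists>a. (w, a, dec2 (fst (enc (map fst w))) (snd (snd (enc (map fst w)))) (map (\<lambda>w. snd (snd w)) w)) \<in> r2.good_triples \<epsilon> \<delta> n). iid_weight (pmf P) w)" for n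
    unfolding p1_def p2_def r1.sum_good_triples[symmetric] r2.sum_good_triples[symmetric] ker0
  proof (rule one_shot_code[where ?A0.0 = "words n A0" and ?A1.0 = "words n UNIV" and ?A2.0 = "words n UNIV"
        and ?d1.0 = "seq_kernel r1.post0" and ?d2.0 = "seq_kernel r2.post0" and ?e1.0 = "seq_kernel2 r1.post1" and ?e2.0 = "seq_kernel2 r2.post1"])
    fix ws as bs assume T: "(ws, as, bs) \<in> r1.good_triples \<epsilon> \<delta> n"
    show "seq_kernel r1.ker0 (map fst ws) as \<le> \<eta> n * (real (ncodes n R0) * real (ncodes n S1)) * seq_kernel r1.post0 (map (\<lambda>w. fst (snd w)) ws) as"
      by (rule order_trans[OF r1.good_triples_density(1)[OF T]])
        (auto simp: \<eta>_def r1.kernels_nonneg J1_def[symmetric] intro!: mult_right_mono powr_le_ncodes_mult rates bounds)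
    show "seq_kernel2 r1.ker1 (map fst ws) as bs \<le> \<eta> n * real (ncodes n R1) * seq_kernel2 r1.post1 (map (\<lambda>w. fst (snd w)) ws) as bs"
      by (rule order_trans[OF r1.good_triples_density(2)[OF T]])
        (auto simp: \<eta>_def r1.kernels_nonneg J1_def[symmetric] intro!: mult_right_mono powr_le_ncodes rates bounds)
  next
    fix ws as bs assume T: "(ws, as, bs) \<in> r2.good_triples \<epsilon> \<delta> n"
    show "seq_kernel r1.ker0 (map fst ws) as \<le> \<eta> n * (real (ncodes n R0) * real (ncodes n S2)) * seq_kernel r2.post0 (map (\<lambda>w. snd (snd w)) ws) as"
      by (rule order_trans[OF r2.good_triples_density(1)[OF T, unfolded ker0]])
        (auto simp: \<eta>_def r2.kernels_nonneg J2_def[symmetric] intro!: mult_right_mono powr_le_ncodes_mult rates bounds)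
    show "seq_kernel2 r2.ker1 (map fst ws) as bs \<le> \<eta> n * real (ncodes n R2) * seq_kernel2 r2.post1 (map (\<lambda>w. snd (snd w)) ws) as bs"
      by (rule order_trans[OF r2.good_triples_density(2)[OF T]])
        (auto simp: \<eta>_def r2.kernels_nonneg J2_def[symmetric] intro!: mult_right_mono powr_le_ncodes rates bounds)
  next
    show "r1.good_triples \<epsilon> \<delta> n \<subseteq> words n UNIV \<times> words n A0 \<times> words n UNIV"
      "r2.good_triples \<epsilon> \<delta> n \<subseteq> words n UNIV \<times> words n A0 \<times> words n UNIV"
      by (rule r1.good_triples_subset r2.good_triples_subset)+
  qed (use \<eta>0 r1.kernels_nonneg r2.kernels_nonneg ncodes_bounds(1) rates r1.fin_A0 in
      \<open>auto intro!: iid_weight_nonneg r1.kernels_sum_le_1 r2.kernels_sum_le_1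
        r1.kernels2_sum_le_1 r2.kernels2_sum_le_1 dest: length_words\<close>)
  \<comment> \<open>Collects all demands on the code of one block length, so that codes for all
    \<open>n\<close> can be chosen at once.\<close>
  define good_code where "good_code n c \<longleftrightarrow> (case c of (enc, dec1, dec2) \<Rightarrow>
    (\<forall>s. enc s \<in> {1..ncodes n R0} \<times> {1..ncodes n S1 * ncodes n R1} \<times> {1..ncodes n S2 * ncodes n R2}) \<and>
    (p1 n + p2 n) / (1 + \<eta> n)\<^sup>2
    \<le> prob_iid P n (\<lambda>ws. jtypical \<epsilon> (law_XV P (\<lambda>s. map_pmf snd (q1 s))) (map fst ws)
          (dec1 (fst (enc (map fst ws))) (fst (snd (enc (map fst ws)))) (map (\<lambda>w. fst (snd w)) ws))) +
      prob_iid P n (\<lambda>ws. jtypical \<epsilon> (law_XV P (\<lambda>s. map_pmf snd (q2 s))) (map fst ws)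
          (dec2 (fst (enc (map fst ws))) (snd (snd (enc (map fst ws)))) (map (\<lambda>w. snd (snd w)) ws))))" for n
      and c :: "('x list \<Rightarrow> nat \<times> nat \<times> nat) \<times> (nat \<Rightarrow> nat \<Rightarrow> 'y1 list \<Rightarrow> 'v1 list) \<times> (nat \<Rightarrow> nat \<Rightarrow> 'y2 list \<Rightarrow> 'v2 list)"
  have "\<exists>c. good_code n c" for n
  proof -
    from ex[of n] obtain enc dec1 dec2 where c:
      "\<forall>s. enc s \<in> {1..ncodes n R0} \<times> {1..ncodes n S1 * ncodes n R1} \<times> {1..ncodes n S2 * ncodes n R2}"
      "(p1 n + p2 n) / (1 + \<eta> n)\<^sup>2
    \<le> prob_iid P n (\<lambda>w. \<exists>a. (w, a, dec1 (fst (enc (map fst w))) (fst (snd (enc (map fst w)))) (map (\<lambda>w. fst (snd w)) w)) \<in> r1.good_triples \<epsilon> \<delta> n) +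
      prob_iid P n (\<lambda>w. \<exists>a. (w, a, dec2 (fst (enc (map fst w))) (snd (snd (enc (map fst w)))) (map (\<lambda>w. snd (snd w)) w)) \<in> r2.good_triples \<epsilon> \<delta> n)"
      unfolding prob_iid_eq by blast
    have "good_code n (enc, dec1, dec2)"
      unfolding good_code_def prod.case
      by (intro conjI c(1) order_trans[OF c(2)] add_mono prob_iid_mono)
        (auto simp: law dest: r1.good_triples_typical r2.good_triples_typical)
    then show ?thesis by blast
  qed
  then obtain c where c: "\<And>n. good_code n (c n)" by metis
  define enc dec1 dec2 where "enc n = fst (c n)" and "dec1 n = fst (snd (c n))" and "dec2 n = snd (snd (c n))" for n
  have code: "good_code n (enc n, dec1 n, dec2 n)" for n
    using c[of n] by (simp add: enc_def dec1_def dec2_def)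
  define f1 f2 where
    "f1 n = prob_iid P n (\<lambda>ws. \<not> jtypical \<epsilon> (law_XV P (\<lambda>s. map_pmf snd (q1 s))) (map fst ws)
          (dec1 n (fst (enc n (map fst ws))) (fst (snd (enc n (map fst ws)))) (map (\<lambda>w. fst (snd w)) ws)))" and
    "f2 n = prob_iid P n (\<lambda>ws. \<not> jtypical \<epsilon> (law_XV P (\<lambda>s. map_pmf snd (q2 s))) (map fst ws)
          (dec2 n (fst (enc n (map fst ws))) (snd (snd (enc n (map fst ws)))) (map (\<lambda>w. snd (snd w)) ws)))" for n
  \<comment> \<open>The right side tends to 0, and both error probabilities are nonnegative, so a
    bound on their sum suffices to squeeze each of them.\<close>
  have f: "f1 n + f2 n \<le> 2 - (p1 n + p2 n) / (1 + \<eta> n)\<^sup>2" for n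
    using code[of n] unfolding good_code_def prod.case f1_def f2_def prob_iid_not by linarith
  have f0: "0 \<le> f1 n" "0 \<le> f2 n" for n
    unfolding f1_def f2_def by (rule prob_iid_nonneg)+
  have "\<eta> \<longlonglongrightarrow> 0"
  proof -
    have "\<eta> = (\<lambda>n. 4 * (2 powr (- \<delta>)) ^ n)"
      by (simp add: \<eta>_def fun_eq_iff powr_realpow[symmetric] powr_powr mult.commute)
    moreover have "(\<lambda>n. 4 * (2 powr (- \<delta>)) ^ n) \<longlonglongrightarrow> 4 * 0"
      using \<open>0 < \<delta>\<close> by (intro tendsto_mult tendsto_const LIMSEQ_power_zero) (simp add: powr_less_one)
    ultimately show ?thesis by simp
  qed
  moreover have "p1 \<longlonglongrightarrow> 1" "p2 \<longlonglongrightarrow> 1"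
    unfolding p1_def p2_def using assms(6,7) by (auto intro!: r1.good_words_prob r2.good_words_prob)
  ultimately have "(\<lambda>n. 2 - (p1 n + p2 n) / (1 + \<eta> n)\<^sup>2) \<longlonglongrightarrow> 2 - (1 + 1) / (1 + 0)\<^sup>2"
    by (intro tendsto_intros) auto
  then have lim: "(\<lambda>n. 2 - (p1 n + p2 n) / (1 + \<eta> n)\<^sup>2) \<longlonglongrightarrow> 0" by simp
  have "f1 \<longlonglongrightarrow> 0"
    by (rule tendsto_sandwich[OF _ _ tendsto_const lim]; rule always_eventually; rule allI)
      (use f f0 in \<open>smt (verit)\<close>)+
  moreover have "f2 \<longlonglongrightarrow> 0"
    by (rule tendsto_sandwich[OF _ _ tendsto_const lim]; rule always_eventually; rule allI)
      (use f f0 in \<open>smt (verit)\<close>)+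
  moreover have "fst (enc n xs) \<in> idx (2 powr (real n * R0)) \<and>
      fst (snd (enc n xs)) \<in> idx (2 powr (real n * (S1 + R1))) \<and>
      snd (snd (enc n xs)) \<in> idx (2 powr (real n * (S2 + R2)))" for n xs
  proof -
    have "enc n xs \<in> {1..ncodes n R0} \<times> {1..ncodes n S1 * ncodes n R1} \<times> {1..ncodes n S2 * ncodes n R2}"
      using code[of n] by (auto simp: good_code_def)
    then show ?thesis
      using ncodes_mult_le[of S1 R1 n] ncodes_mult_le[of S2 R2 n] rates
      unfolding idx_def ncodes_def[symmetric] by (cases "enc n xs") auto
  qed
  ultimately show ?thesis
    unfolding eps_achievable_def prod.case Let_def f1_def f2_def
    by (intro exI[of _ enc] exI[of _ dec1] exI[of _ dec2] conjI allI impI) auto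
qed

text \<open>By the chain rule the sum-rate constraint reads \<open>b1 + a1 < R0 + R1\<close>. The
  second layer receives \<open>a1 + 2 * \<delta>\<close> of the private rate, and the surplus is
  left for bins of \<open>V\<^sub>0\<close>; receiver 2 is treated alike.\<close>

lemma inner_point_achievable:
  fixes P :: "('x::finite \<times> 'y1::finite \<times> 'y2::finite) pmf"
    and PV1 :: "'x \<Rightarrow> 'v1::finite pmf" and PV2 :: "'x \<Rightarrow> 'v2::finite pmf"
  assumes adm: "admissible PV1 PV2 Q" and "0 \<le> R0" "0 \<le> R1" "0 \<le> R2"
  defines "J \<equiv> joint_law P Q"
  assumes R1: "cmi J rvX rvV1 (\<lambda>w. (rvV0 w, rvY1 w)) < R1"
    and R2: "cmi J rvX rvV2 (\<lambda>w. (rvV0 w, rvY2 w)) < R2"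
    and R01: "cmi J rvX (\<lambda>w. (rvV0 w, rvV1 w)) rvY1 < R0 + R1"
    and R02: "cmi J rvX (\<lambda>w. (rvV0 w, rvV2 w)) rvY2 < R0 + R2"
  shows "achievable P PV1 PV2 (R0, R1, R2)"
  unfolding achievable_def
proof (intro allI impI)
  fix \<epsilon> :: real assume \<epsilon>: "0 < \<epsilon>"
  from adm obtain A0 where A0: "finite A0" "\<And>s. fst ` set_pmf (Q s) \<subseteq> A0"
    and marg: "\<And>s. map_pmf (\<lambda>v. fst (snd v)) (Q s) = PV1 s" "\<And>s. map_pmf (\<lambda>v. snd (snd v)) (Q s) = PV2 s"
    unfolding admissible_def by blast
  define q1 where "q1 s = map_pmf (\<lambda>v. (fst v, fst (snd v))) (Q s)" for s
  define q2 where "q2 s = map_pmf (\<lambda>v. (fst v, snd (snd v))) (Q s)" for s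
  have r1: "receiver q1 A0" and r2: "receiver q2 A0"
    using A0 by (unfold_locales; fastforce simp: q1_def q2_def)+
  have same: "map_pmf fst (q1 s) = map_pmf fst (q2 s)" for s
    by (simp add: q1_def q2_def pmf.map_comp comp_def)
  have J1: "receiver.J P q1 = map_pmf (\<lambda>w. (fst w, rvV0 w, rvV1 w)) J"
    and J2: "receiver.J P q2 = map_pmf (\<lambda>w. (fst w, rvV0 w, rvV2 w)) J"
    by (simp_all add: receiver.J_def[OF r1] receiver.J_def[OF r2] q1_def q2_def J_def joint_law_def
        map_bind_pmf pmf.map_comp comp_def rvV0_def rvV1_def rvV2_def)
  have "finite (set_pmf (receiver.J P q1))" "finite (set_pmf (receiver.J P q2))"
    by (intro receiver.finite_J[OF r1] receiver.finite_J[OF r2])+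
  note pos = this[THEN cmi_nonneg]
  define a1 where "a1 = cmi J rvX rvV1 (\<lambda>w. (rvV0 w, rvY1 w))"
  define a2 where "a2 = cmi J rvX rvV2 (\<lambda>w. (rvV0 w, rvY2 w))"
  define b1 where "b1 = cmi J rvX rvV0 rvY1"
  define b2 where "b2 = cmi J rvX rvV0 rvY2"
  have eqs: "cmi (receiver.J P q1) (\<lambda>z. fst (fst z)) (\<lambda>z. fst (snd z)) (\<lambda>z. fst (snd (fst z))) = b1"
    "cmi (receiver.J P q1) (\<lambda>z. fst (fst z)) (\<lambda>z. snd (snd z)) (\<lambda>z. (fst (snd z), fst (snd (fst z)))) = a1"
    "cmi (receiver.J P q2) (\<lambda>z. fst (fst z)) (\<lambda>z. fst (snd z)) (\<lambda>z. snd (snd (fst z))) = b2"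
    "cmi (receiver.J P q2) (\<lambda>z. fst (fst z)) (\<lambda>z. snd (snd z)) (\<lambda>z. (fst (snd z), snd (snd (fst z)))) = a2"
    unfolding J1 J2 cmi_map_pmf a1_def a2_def b1_def b2_def
    by (simp_all add: rvX_def[abs_def] rvY1_def[abs_def] rvY2_def[abs_def])
  \<comment> \<open>Nonnegative mutual information makes \<open>a1 + 2 * \<delta>\<close> and
    \<open>a2 + 2 * \<delta>\<close> admissible as rates.\<close>
  have a: "0 \<le> a1" "0 \<le> a2"
    unfolding eqs(2)[symmetric] eqs(4)[symmetric] by (rule pos(1), rule pos(2))
  have lt: "a1 < R1" "a2 < R2" "b1 + a1 < R0 + R1" "b2 + a2 < R0 + R2"
    using R1 R2 R01 R02 by (simp_all add: a1_def a2_def b1_def b2_def cmi_chain)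
  \<comment> \<open>A quarter of the smallest slack: \<open>2 * \<delta>\<close> goes to the second
    layer and a further \<open>2 * \<delta>\<close> must remain for the first.\<close>
  define \<delta> where "\<delta> = min (min (R1 - a1) (R2 - a2)) (min (R0 + R1 - a1 - b1) (R0 + R2 - a2 - b2)) / 4"
  have \<delta>: "0 < \<delta>" "4 * \<delta> \<le> R1 - a1" "4 * \<delta> \<le> R2 - a2" "4 * \<delta> \<le> R0 + R1 - a1 - b1" "4 * \<delta> \<le> R0 + R2 - a2 - b2"
    using lt by (auto simp: \<delta>_def)
  have "eps_achievable P (\<lambda>s. map_pmf snd (q1 s)) (\<lambda>s. map_pmf snd (q2 s)) \<epsilon>
      (R0, (R1 - (a1 + 2 * \<delta>)) + (a1 + 2 * \<delta>), (R2 - (a2 + 2 * \<delta>)) + (a2 + 2 * \<delta>))"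
    by (rule eps_achievable_split_rates[where \<delta> = \<delta>, OF r1 r2 same]) (use \<epsilon> \<delta> a assms(2) in \<open>auto simp: eqs\<close>)
  moreover have "(\<lambda>s. map_pmf snd (q1 s)) = PV1" "(\<lambda>s. map_pmf snd (q2 s)) = PV2"
    using marg by (auto simp: q1_def q2_def pmf.map_comp comp_def)
  ultimately show "eps_achievable P PV1 PV2 \<epsilon> (R0, R1, R2)" by simp
qed

section \<open>Time sharing\<close>

definition binary_entropy :: "real \<Rightarrow> real" where
  "binary_entropy u = - (u * log 2 u) - (1 - u) * log 2 (1 - u)"

text \<open>With disjoint supports a value reveals its component, so each logarithm splits into that
  of the mixture weight and that of the component mass.\<close>

lemma entropy_pmf_disjoint_mixture:
  assumes u: "0 < u" "u < 1" and fin: "finite (set_pmf p)" "finite (set_pmf q)"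
    and disj: "set_pmf p \<inter> set_pmf q = {}"
  shows "entropy_pmf (bind_pmf (bernoulli_pmf u) (\<lambda>b. if b then p else q)) =
    binary_entropy u + u * entropy_pmf p + (1 - u) * entropy_pmf q"
proof -
  let ?m = "bind_pmf (bernoulli_pmf u) (\<lambda>b. if b then p else q)"
  have pmf: "pmf ?m a = u * pmf p a + (1 - u) * pmf q a" for a
    using u by (simp add: pmf_bind)
  have set: "set_pmf ?m = set_pmf p \<union> set_pmf q"
    using u by (auto simp: set_pmf_bernoulli split: if_splits)
  have P: "pmf ?m a * log 2 (pmf ?m a) = u * log 2 u * pmf p a + u * (pmf p a * log 2 (pmf p a))" if "a \<in> set_pmf p" for a
  proof -
    have "pmf q a = 0" using disj that by (auto simp: pmf_eq_0_set_pmf)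
    then show ?thesis using u that pmf_positive[OF that] by (simp add: pmf log_mult algebra_simps)
  qed
  have Q: "pmf ?m a * log 2 (pmf ?m a) = (1 - u) * log 2 (1 - u) * pmf q a + (1 - u) * (pmf q a * log 2 (pmf q a))"
    if "a \<in> set_pmf q" for a
  proof -
    have "pmf p a = 0" using disj that by (auto simp: pmf_eq_0_set_pmf)
    then have "pmf ?m a * log 2 (pmf ?m a) = (1 - u) * pmf q a * (log 2 (1 - u) + log 2 (pmf q a))"
      using u that pmf_positive[OF that] by (simp add: pmf log_mult)
    then show ?thesis by (simp add: algebra_simps)
  qed
  have "(\<Sum>a\<in>set_pmf ?m. pmf ?m a * log 2 (pmf ?m a)) =
    (\<Sum>a\<in>set_pmf p. pmf ?m a * log 2 (pmf ?m a)) + (\<Sum>a\<in>set_pmf q. pmf ?m a * log 2 (pmf ?m a))"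
    unfolding set using fin disj by (rule sum.union_disjoint)
  also have "\<dots> = (u * log 2 u * (\<Sum>a\<in>set_pmf p. pmf p a) + u * (\<Sum>a\<in>set_pmf p. pmf p a * log 2 (pmf p a))) +
     ((1 - u) * log 2 (1 - u) * (\<Sum>a\<in>set_pmf q. pmf q a) + (1 - u) * (\<Sum>a\<in>set_pmf q. pmf q a * log 2 (pmf q a)))"
    by (simp add: P Q sum.distrib sum_distrib_left cong: sum.cong)
  finally show ?thesis
    using fin by (simp add: entropy_pmf_def binary_entropy_def sum_pmf_eq_1)
qed

text \<open>Stores the time-sharing bit in the parity, as the enlarged auxiliary letter must again
  be a natural number.\<close>

definition tag :: "bool \<Rightarrow> nat \<Rightarrow> nat" where
  "tag b v = 2 * v + of_bool b"

lemma tag_eq_iff: "tag b v = tag b' v' \<longleftrightarrow> b = b' \<and> v = v'"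
  unfolding tag_def by (cases b; cases b'; simp; presburger)

text \<open>The bit has the same law for every \<open>x\<close>, hence is independent of the source,
  and it is recorded in \<open>V\<^sub>0\<close>.\<close>

definition time_share :: "real \<Rightarrow> ('x \<Rightarrow> (nat \<times> 'v) pmf) \<Rightarrow> ('x \<Rightarrow> (nat \<times> 'v) pmf) \<Rightarrow> 'x \<Rightarrow> (nat \<times> 'v) pmf" where
  "time_share u Q Q' x = bind_pmf (bernoulli_pmf u) (\<lambda>b. map_pmf (\<lambda>v. (tag b (fst v), snd v)) (if b then Q x else Q' x))"

lemma joint_law_time_share:
  "joint_law P (time_share u Q Q') = bind_pmf (bernoulli_pmf u)
    (\<lambda>b. map_pmf (\<lambda>w. (fst w, tag b (fst (snd w)), snd (snd w))) (joint_law P (if b then Q else Q')))"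
  unfolding joint_law_def time_share_def map_bind_pmf
  by (subst bind_commute_pmf) (auto simp: map_bind_pmf pmf.map_comp comp_def intro!: bind_pmf_cong)

text \<open>The assumption on \<open>\<psi>\<close> says that \<open>f\<close> exposes the bit, so
  the two branches have disjoint supports and the mixture formula applies.\<close>

lemma Ent_time_share:
  assumes u: "0 < u" "u < 1" and fin: "finite (set_pmf (joint_law P Q))" "finite (set_pmf (joint_law P Q'))"
    and inj: "\<And>b b' a a'. \<psi> b a = \<psi> b' a' \<Longrightarrow> b = b' \<and> a = a'"
    and f: "\<And>b w. f (fst w, tag b (fst (snd w)), snd (snd w)) = \<psi> b (f w)"
  shows "Ent (joint_law P (time_share u Q Q')) f =
    binary_entropy u + u * Ent (joint_law P Q) f + (1 - u) * Ent (joint_law P Q') f"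
proof -
  let ?p = "map_pmf (\<lambda>w. \<psi> True (f w)) (joint_law P Q)" and ?q = "map_pmf (\<lambda>w. \<psi> False (f w)) (joint_law P Q')"
  have "map_pmf f (joint_law P (time_share u Q Q')) = bind_pmf (bernoulli_pmf u) (\<lambda>b. if b then ?p else ?q)"
    unfolding joint_law_time_share map_bind_pmf
    by (auto simp: pmf.map_comp comp_def f intro!: bind_pmf_cong)
  then have "Ent (joint_law P (time_share u Q Q')) f = binary_entropy u + u * entropy_pmf ?p + (1 - u) * entropy_pmf ?q"
    unfolding Ent_def by (simp only:) (rule entropy_pmf_disjoint_mixture; use u fin in \<open>auto dest: inj\<close>)
  moreover have "Ent (joint_law P Q) (\<lambda>w. \<psi> True (f w)) = Ent (joint_law P Q) f"
    "Ent (joint_law P Q') (\<lambda>w. \<psi> False (f w)) = Ent (joint_law P Q') f"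
    using inj by (auto intro!: Ent_inj simp: inj_def)
  ultimately show ?thesis by (simp add: Ent_def)
qed

lemma Ent_source: "Ent (joint_law P Q) (\<lambda>w. g (fst w)) = Ent P g"
proof -
  have "map_pmf fst (joint_law P Q) = P"
    by (simp add: joint_law_def map_bind_pmf pmf.map_comp comp_def bind_return_pmf')
  then show ?thesis using Ent_map_pmf[of fst "joint_law P Q" g] by simp
qed

text \<open>In the first identity all four entropies contain \<open>V\<^sub>0\<close>, two with each
  sign, so the terms \<open>binary_entropy u\<close> cancel. In the second only two contain it, with
  opposite signs; the other two depend on the source alone and are the same for every test
  channel.\<close>

lemma cmi_time_share:
  fixes V :: "'v1 \<times> 'v2 \<Rightarrow> 'c"
  assumes u: "0 < u" "u < 1" and fin: "finite (set_pmf (joint_law P Q))" "finite (set_pmf (joint_law P Q'))"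
  defines "J \<equiv> joint_law P (time_share u Q Q')"
  shows "cmi J rvX (\<lambda>w. V (snd (snd w))) (\<lambda>w. (rvV0 w, Y (fst w))) =
      u * cmi (joint_law P Q) rvX (\<lambda>w. V (snd (snd w))) (\<lambda>w. (rvV0 w, Y (fst w))) +
      (1 - u) * cmi (joint_law P Q') rvX (\<lambda>w. V (snd (snd w))) (\<lambda>w. (rvV0 w, Y (fst w)))" (is ?A)
    and "cmi J rvX (\<lambda>w. (rvV0 w, V (snd (snd w)))) (\<lambda>w. Y (fst w)) =
      u * cmi (joint_law P Q) rvX (\<lambda>w. (rvV0 w, V (snd (snd w)))) (\<lambda>w. Y (fst w)) +
      (1 - u) * cmi (joint_law P Q') rvX (\<lambda>w. (rvV0 w, V (snd (snd w)))) (\<lambda>w. Y (fst w))" (is ?B)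
proof -
  note E = Ent_time_share[OF u fin]
  have "Ent J (\<lambda>w. (rvX w, rvV0 w, Y (fst w))) = binary_entropy u +
      u * Ent (joint_law P Q) (\<lambda>w. (rvX w, rvV0 w, Y (fst w))) + (1 - u) * Ent (joint_law P Q') (\<lambda>w. (rvX w, rvV0 w, Y (fst w)))"
    unfolding J_def by (rule E[where \<psi> = "\<lambda>b t. (fst t, tag b (fst (snd t)), snd (snd t))"])
      (auto simp: tag_eq_iff rvX_def rvV0_def prod_eq_iff)
  moreover have "Ent J (\<lambda>w. (V (snd (snd w)), rvV0 w, Y (fst w))) = binary_entropy u +
      u * Ent (joint_law P Q) (\<lambda>w. (V (snd (snd w)), rvV0 w, Y (fst w))) +
      (1 - u) * Ent (joint_law P Q') (\<lambda>w. (V (snd (snd w)), rvV0 w, Y (fst w)))"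
    unfolding J_def by (rule E[where \<psi> = "\<lambda>b t. (fst t, tag b (fst (snd t)), snd (snd t))"])
      (auto simp: tag_eq_iff rvV0_def prod_eq_iff)
  moreover have "Ent J (\<lambda>w. (rvX w, V (snd (snd w)), rvV0 w, Y (fst w))) = binary_entropy u +
      u * Ent (joint_law P Q) (\<lambda>w. (rvX w, V (snd (snd w)), rvV0 w, Y (fst w))) +
      (1 - u) * Ent (joint_law P Q') (\<lambda>w. (rvX w, V (snd (snd w)), rvV0 w, Y (fst w)))"
    unfolding J_def by (rule E[where \<psi> = "\<lambda>b t. (fst t, fst (snd t), tag b (fst (snd (snd t))), snd (snd (snd t)))"])
      (auto simp: tag_eq_iff rvX_def rvV0_def prod_eq_iff)
  moreover have "Ent J (\<lambda>w. (rvV0 w, Y (fst w))) = binary_entropy u +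
      u * Ent (joint_law P Q) (\<lambda>w. (rvV0 w, Y (fst w))) + (1 - u) * Ent (joint_law P Q') (\<lambda>w. (rvV0 w, Y (fst w)))"
    unfolding J_def by (rule E[where \<psi> = "\<lambda>b t. (tag b (fst t), snd t)"])
      (auto simp: tag_eq_iff rvV0_def prod_eq_iff)
  ultimately show ?A unfolding cmi_def by (simp add: algebra_simps)
  have "Ent J (\<lambda>w. ((rvV0 w, V (snd (snd w))), Y (fst w))) = binary_entropy u +
      u * Ent (joint_law P Q) (\<lambda>w. ((rvV0 w, V (snd (snd w))), Y (fst w))) +
      (1 - u) * Ent (joint_law P Q') (\<lambda>w. ((rvV0 w, V (snd (snd w))), Y (fst w)))"
    unfolding J_def by (rule E[where \<psi> = "\<lambda>b t. ((tag b (fst (fst t)), snd (fst t)), snd t)"])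
      (auto simp: tag_eq_iff rvV0_def prod_eq_iff)
  moreover have "Ent J (\<lambda>w. (rvX w, (rvV0 w, V (snd (snd w))), Y (fst w))) = binary_entropy u +
      u * Ent (joint_law P Q) (\<lambda>w. (rvX w, (rvV0 w, V (snd (snd w))), Y (fst w))) +
      (1 - u) * Ent (joint_law P Q') (\<lambda>w. (rvX w, (rvV0 w, V (snd (snd w))), Y (fst w)))"
    unfolding J_def by (rule E[where \<psi> = "\<lambda>b t. (fst t, (tag b (fst (fst (snd t))), snd (fst (snd t))), snd (snd t))"])
      (auto simp: tag_eq_iff rvX_def rvV0_def prod_eq_iff)
  moreover have "Ent (joint_law P S) (\<lambda>w. (rvX w, Y (fst w))) = Ent P (\<lambda>s. (fst s, Y s))"
    "Ent (joint_law P S) (\<lambda>w. Y (fst w)) = Ent P Y" for S :: "'a \<Rightarrow> (nat \<times> 'v1 \<times> 'v2) pmf"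
    unfolding rvX_def by (rule Ent_source)+
  ultimately show ?B unfolding cmi_def J_def by (simp add: algebra_simps)
qed

lemma admissible_time_share:
  assumes "admissible PV1 PV2 Q" "admissible PV1 PV2 Q'"
  shows "admissible PV1 PV2 (time_share u Q Q')"
proof -
  from assms obtain A A' where A: "finite A" "\<And>x. fst ` set_pmf (Q x) \<subseteq> A" "finite A'" "\<And>x. fst ` set_pmf (Q' x) \<subseteq> A'"
    unfolding admissible_def by blast
  have "fst ` set_pmf (time_share u Q Q' x) \<subseteq> (\<lambda>(b, a). tag b a) ` (UNIV \<times> (A \<union> A'))" for x
  proof
    fix a assume "a \<in> fst ` set_pmf (time_share u Q Q' x)"
    then obtain b v where "a = tag b (fst v)" "v \<in> set_pmf (if b then Q x else Q' x)"
      by (auto simp: time_share_def)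
    then show "a \<in> (\<lambda>(b, a). tag b a) ` (UNIV \<times> (A \<union> A'))"
      using A(2,4)[of x] by (intro image_eqI[of _ _ "(b, fst v)"]) (auto split: if_splits)
  qed
  moreover have "finite ((\<lambda>(b, a). tag b a) ` (UNIV \<times> (A \<union> A')))" using A by auto
  moreover have "map_pmf (\<lambda>v. fst (snd v)) (time_share u Q Q' x) = PV1 x"
    "map_pmf (\<lambda>v. snd (snd v)) (time_share u Q Q' x) = PV2 x" for x
    using assms by (simp_all add: time_share_def admissible_def map_bind_pmf pmf.map_comp comp_def if_distrib bind_pmf_const cong: if_cong)
  ultimately show ?thesis unfolding admissible_def by blast
qed

lemma finite_joint_law:
  fixes P :: "('x::finite \<times> 'y1::finite \<times> 'y2::finite) pmf"
    and PV1 :: "'x \<Rightarrow> 'v1::finite pmf" and PV2 :: "'x \<Rightarrow> 'v2::finite pmf"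
  assumes "admissible PV1 PV2 Q"
  shows "finite (set_pmf (joint_law P Q))"
proof -
  from assms obtain A where A: "finite A" "\<And>x. fst ` set_pmf (Q x) \<subseteq> A" unfolding admissible_def by blast
  have "set_pmf (joint_law P Q) \<subseteq> UNIV \<times> A \<times> UNIV" using A(2) by (fastforce simp: joint_law_def)
  then show ?thesis by (rule finite_subset) (simp add: A)
qed

section \<open>Convexity of the inner region\<close>

lemma convex_comb_strict:
  fixes u :: real
  assumes "0 < u" "u < 1" "a < b" "a' < b'"
  shows "u * a + (1 - u) * a' < u * b + (1 - u) * b'"
  using assms by (intro add_strict_mono mult_strict_left_mono) auto

lemma inner_constraints_time_share:
  fixes P :: "('x::finite \<times> 'y1::finite \<times> 'y2::finite) pmf"
    and PV1 :: "'x \<Rightarrow> 'v1::finite pmf" and PV2 :: "'x \<Rightarrow> 'v2::finite pmf"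
  assumes u: "0 < u" "u < 1" and adm: "admissible PV1 PV2 Q" "admissible PV1 PV2 Q'"
  defines "J \<equiv> joint_law P (time_share u Q Q')"
  shows "cmi J rvX rvV1 (\<lambda>w. (rvV0 w, rvY1 w)) = u * cmi (joint_law P Q) rvX rvV1 (\<lambda>w. (rvV0 w, rvY1 w)) +
      (1 - u) * cmi (joint_law P Q') rvX rvV1 (\<lambda>w. (rvV0 w, rvY1 w))"
    "cmi J rvX rvV2 (\<lambda>w. (rvV0 w, rvY2 w)) = u * cmi (joint_law P Q) rvX rvV2 (\<lambda>w. (rvV0 w, rvY2 w)) +
      (1 - u) * cmi (joint_law P Q') rvX rvV2 (\<lambda>w. (rvV0 w, rvY2 w))"
    "cmi J rvX (\<lambda>w. (rvV0 w, rvV1 w)) rvY1 = u * cmi (joint_law P Q) rvX (\<lambda>w. (rvV0 w, rvV1 w)) rvY1 +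
      (1 - u) * cmi (joint_law P Q') rvX (\<lambda>w. (rvV0 w, rvV1 w)) rvY1"
    "cmi J rvX (\<lambda>w. (rvV0 w, rvV2 w)) rvY2 = u * cmi (joint_law P Q) rvX (\<lambda>w. (rvV0 w, rvV2 w)) rvY2 +
      (1 - u) * cmi (joint_law P Q') rvX (\<lambda>w. (rvV0 w, rvV2 w)) rvY2"
proof -
  note C = cmi_time_share[OF u finite_joint_law[OF adm(1), of P] finite_joint_law[OF adm(2), of P]]
  note C1 = C[where V = fst and Y = "\<lambda>s. fst (snd s)"]
  note C2 = C[where V = snd and Y = "\<lambda>s. snd (snd s)"]
  have rv: "rvV1 = (\<lambda>w. fst (snd (snd w)))" "rvV2 = (\<lambda>w. snd (snd (snd w)))"
    "rvY1 = (\<lambda>w. fst (snd (fst w)))" "rvY2 = (\<lambda>w. snd (snd (fst w)))"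
    by (simp_all add: fun_eq_iff rvV1_def rvV2_def rvY1_def rvY2_def)
  show "cmi J rvX rvV1 (\<lambda>w. (rvV0 w, rvY1 w)) = u * cmi (joint_law P Q) rvX rvV1 (\<lambda>w. (rvV0 w, rvY1 w)) +
      (1 - u) * cmi (joint_law P Q') rvX rvV1 (\<lambda>w. (rvV0 w, rvY1 w))"
    unfolding rv J_def by (rule C1)
  show "cmi J rvX rvV2 (\<lambda>w. (rvV0 w, rvY2 w)) = u * cmi (joint_law P Q) rvX rvV2 (\<lambda>w. (rvV0 w, rvY2 w)) +
      (1 - u) * cmi (joint_law P Q') rvX rvV2 (\<lambda>w. (rvV0 w, rvY2 w))"
    unfolding rv J_def by (rule C2)
  show "cmi J rvX (\<lambda>w. (rvV0 w, rvV1 w)) rvY1 = u * cmi (joint_law P Q) rvX (\<lambda>w. (rvV0 w, rvV1 w)) rvY1 +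
      (1 - u) * cmi (joint_law P Q') rvX (\<lambda>w. (rvV0 w, rvV1 w)) rvY1"
    unfolding rv J_def by (rule C1)
  show "cmi J rvX (\<lambda>w. (rvV0 w, rvV2 w)) rvY2 = u * cmi (joint_law P Q) rvX (\<lambda>w. (rvV0 w, rvV2 w)) rvY2 +
      (1 - u) * cmi (joint_law P Q') rvX (\<lambda>w. (rvV0 w, rvV2 w)) rvY2"
    unfolding rv J_def by (rule C2)
qed

text \<open>The closure of a convex set is convex, so it suffices to mix points that satisfy the
  strict constraints.\<close>

lemma convex_R_inner:
  fixes P :: "('x::finite \<times> 'y1::finite \<times> 'y2::finite) pmf"
    and PV1 :: "'x \<Rightarrow> 'v1::finite pmf" and PV2 :: "'x \<Rightarrow> 'v2::finite pmf"
  shows "convex (R_inner P PV1 PV2)"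
proof -
  define ok where "ok (Q :: 'x \<Rightarrow> (nat \<times> 'v1 \<times> 'v2) pmf) R \<longleftrightarrow> (case R of (R0, R1, R2) \<Rightarrow>
     cmi (joint_law P Q) rvX rvV1 (\<lambda>w. (rvV0 w, rvY1 w)) < R1 \<and>
     cmi (joint_law P Q) rvX rvV2 (\<lambda>w. (rvV0 w, rvY2 w)) < R2 \<and>
     cmi (joint_law P Q) rvX (\<lambda>w. (rvV0 w, rvV1 w)) rvY1 < R0 + R1 \<and>
     cmi (joint_law P Q) rvX (\<lambda>w. (rvV0 w, rvV2 w)) rvY2 < R0 + R2)" for Q and R :: "real \<times> real \<times> real"
  define S where "S = {(R0, R1, R2). 0 \<le> R0 \<and> 0 \<le> R1 \<and> 0 \<le> R2 \<and>
    (\<exists>Q. admissible PV1 PV2 Q \<and> ok Q (R0, R1, R2))}"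
  have mix: "(u * R0 + (1 - u) * R0', u * R1 + (1 - u) * R1', u * R2 + (1 - u) * R2') \<in> S"
    if R: "(R0, R1, R2) \<in> S" "(R0', R1', R2') \<in> S" and u: "0 < u" "u < 1" for u R0 R1 R2 R0' R1' R2'
  proof -
    from R obtain Q Q' where Q: "admissible PV1 PV2 Q" "ok Q (R0, R1, R2)" "admissible PV1 PV2 Q'" "ok Q' (R0', R1', R2')"
      and nn: "0 \<le> R0" "0 \<le> R1" "0 \<le> R2" "0 \<le> R0'" "0 \<le> R1'" "0 \<le> R2'"
      by (auto simp: S_def)
    \<comment> \<open>Regroups the sum-rate constraints so that they too become convex combinations
      of the given ones.\<close>
    have lin: "u * R0 + (1 - u) * R0' + (u * r + (1 - u) * r') = u * (R0 + r) + (1 - u) * (R0' + r')" for r r'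
      by (simp add: algebra_simps)
    have "ok (time_share u Q Q') (u * R0 + (1 - u) * R0', u * R1 + (1 - u) * R1', u * R2 + (1 - u) * R2')"
      using Q(2,4) unfolding ok_def prod.case inner_constraints_time_share[OF u Q(1,3)] lin
      by (auto intro!: convex_comb_strict u)
    then show ?thesis
      using admissible_time_share[OF Q(1,3)] nn u by (auto simp: S_def)
  qed
  have "convex S"
    unfolding convex_alt
  proof (intro ballI allI impI)
    fix R R' and u :: real assume *: "R \<in> S" "R' \<in> S" "0 \<le> u \<and> u \<le> 1"
    obtain R0 R1 R2 R0' R1' R2' where "R = (R0, R1, R2)" "R' = (R0', R1', R2')" by (metis surj_pair)
    \<comment> \<open>Time sharing needs both branches to have positive weight; \<open>u = 0\<close>
      and \<open>u = 1\<close> return an endpoint.\<close>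
    then show "(1 - u) *\<^sub>R R + u *\<^sub>R R' \<in> S"
      using * mix[of R0' R1' R2' R0 R1 R2 u] by (cases "u = 0"; cases "u = 1") (auto simp: add.commute)
  qed
  moreover have "R_inner P PV1 PV2 = closure S"
    by (simp add: R_inner_def S_def ok_def Let_def)
  ultimately show ?thesis by (simp add: convex_closure)
qed

theorem theorem2:
  fixes P :: "('x::finite \<times> 'y1::finite \<times> 'y2::finite) pmf"
    and PV1 :: "'x \<Rightarrow> 'v1::finite pmf"
    and PV2 :: "'x \<Rightarrow> 'v2::finite pmf"
  shows "R_inner_star P PV1 PV2 \<subseteq> R_inner P PV1 PV2 \<and>
         R_inner P PV1 PV2 \<subseteq> R_LGW P PV1 PV2 \<and>
         convex (R_inner P PV1 PV2)"
proof (intro conjI)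
  \<comment> \<open>By the chain rule, adding the bound on \<open>R0\<close> to that on a private
    rate gives the corresponding sum-rate constraint.\<close>
  show "R_inner_star P PV1 PV2 \<subseteq> R_inner P PV1 PV2"
    unfolding R_inner_star_def R_inner_def Let_def
    by (intro closure_mono) (auto simp: cmi_chain; fastforce intro: add_strict_mono)
  show "R_inner P PV1 PV2 \<subseteq> R_LGW P PV1 PV2"
    unfolding R_inner_def R_LGW_def Let_def
    by (intro closure_mono) (auto intro: inner_point_achievable)
  show "convex (R_inner P PV1 PV2)" by (rule convex_R_inner)
qed

end
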